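(* Suppose $\rho_q=\mathrm{Rq}(q)$ satisfies $\lambda_1\le\rho_q<\lambda_1+\frac{\lambda_2-\lambda_1}{2+\chi}$, and let $\kappa=L/\mu$. Assume that (i) the step-size $\tau$ satisfies $0<\tau\le\kappa^{-1/2}$; (ii) the initial vector $x_0\in\mathcal{X}$ satisfies $$0\le \mathrm{Rq}(x_0)-\lambda_1\le\frac{1}{\max\{8\kappa,\,2\kappa(1+\tau\kappa)^2\}}\,(\rho_q-\lambda_1);$$ (iii) $z_0=x_0$. Then the sequence $\{x_k\}$ generated by the EIC iteration satisfies, for every $k\ge1$, $$\mathrm{Rq}(x_k)\le\mathrm{Rq}(x_{k-1})\le\dots\le\mathrm{Rq}(x_0)$$ and $$\mathrm{Rq}(x_k)-\lambda_1\le 2(1-\tau)^k\bigl(\mathrm{Rq}(x_0)-\lambda_1\bigr).$$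
   Context: Let $A,M\in\mathbb{R}^{n\times n}$ be symmetric positive definite. The eigenvalues of the pencil $(A,M)$ are $0<\lambda_1<\lambda_2\le\dots\le\lambda_n$, with eigenvectors $u_1,\dots,u_n$: $Au_i=\lambda_iMu_i$, $u_i^{\mathsf T}Mu_j=0$ for $i\ne j$, $\|u_i\|_M=1$, where $\|x\|_M=(x^{\mathsf T}Mx)^{1/2}$. $\mathrm{Rq}(x)=\frac{x^{\mathsf T}Ax}{x^{\mathsf T}Mx}$. Let $q\in\mathbb{R}^n$ satisfy $\|q\|_M=1$, $q^{\mathsf T}Mu_1>0$, and write $\rho_q=\mathrm{Rq}(q)$. Let $Q\in\mathbb{R}^{n\times(n-1)}$ be such that $[q,Q]^{\mathsf T}M[q,Q]=I$. Define $\mathcal{X}=\{x\in\mathbb{R}^n: \|x\|_M=1,\ q^{\mathsf T}Mx>0,\ \mathrm{Rq}(x)\le\rho_q\}$. Let $B=Q^{\mathsf T}AQ$ and let $\xi_{\min},\xi_{\max}$ be the smallest and largest eigenvalues of $B$. Define $$\chi=\frac{8\lambda_{2}}{\lambda_{1}}\frac{\xi_{\max}}{\xi_{\min}}\Bigl(\frac{\lambda_{2}+\lambda_{1}}{2(\lambda_{2}-\lambda_{1})}\Bigr)^{1/2},$$ $$\mu=2\xi_{\min}\Bigl(1-\frac{4(\rho_{q}-\lambda_{1})}{\lambda_{2}-\lambda_{1}}\Bigr)\Bigl(1-\frac{\lambda_{1}}{\lambda_{2}}-\frac{2+\chi}{\lambda_{2}}(\rho_{q}-\lambda_{1})\Bigr),$$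 $$L=2\xi_{\max}\Bigl(1-\frac{\lambda_{1}}{\lambda_{n}}+\frac{\chi}{\lambda_{2}}\frac{\xi_{\min}}{\xi_{\max}}(\rho_{q}-\lambda_{1})\Bigr).$$ EIC iteration (step-size $\tau$). Starting from $x_0,z_0\in\mathcal{X}$, for $k=0,1,2,\dots$: $$\overline{x}_k=\frac{1}{\eta_1}\Bigl(\frac{x_k}{q^{\mathsf T}Mx_k}+\frac{\tau z_k}{q^{\mathsf T}Mz_k}\Bigr),\qquad r_k=2\bigl(A\overline{x}_k-\mathrm{Rq}(\overline{x}_k)M\overline{x}_k\bigr),$$ $$z_{k+1}=\frac{1}{\eta_2}\Bigl(\frac{(1-\tau)z_k}{q^{\mathsf T}Mz_k}+\frac{\tau\overline{x}_k}{q^{\mathsf T}M\overline{x}_k}-\frac{\tau(q^{\mathsf T}M\overline{x}_k)(I-qq^{\mathsf T}M)M^{-1}r_k}{\mu}\Bigr),$$ $$x_{k+1}=\operatorname*{arg\,min}_{x\in\mathcal{X}\cap\mathrm{span}\{q,x_k,\overline{x}_k,M^{-1}r_k\}}\mathrm{Rq}(x),$$ where $\eta_1,\eta_2>0$ (depending on $k$) are normalization factors making $\|\overline{x}_k\|_M=1$ and $\|z_{k+1}\|_M=1$. *)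

theory Defs
  imports "HOL-Analysis.Analysis"
begin

definition sym_pos_def :: "real^'n^'n \<Rightarrow> bool" where
  "sym_pos_def A \<longleftrightarrow> transpose A = A \<and> (\<forall>x. x \<noteq> 0 \<longrightarrow> x \<bullet> (A *v x) > 0)"

definition minner :: "real^'n^'n \<Rightarrow> real^'n \<Rightarrow> real^'n \<Rightarrow> real" where
  "minner M x y = x \<bullet> (M *v y)"

definition mnorm :: "real^'n^'n \<Rightarrow> real^'n \<Rightarrow> real" where
  "mnorm M x = sqrt (minner M x x)"

definition Rq :: "real^'n^'n \<Rightarrow> real^'n^'n \<Rightarrow> real^'n \<Rightarrow> real" where
  "Rq A M x = minner A x x / minner M x x"

text \<open>The real spectrum. It is finite and nonempty when \<open>B\<close> is symmetric, so that
  \<open>Min (real_spectrum B)\<close> and \<open>Max (real_spectrum B)\<close> are then the extreme eigenvalues.\<close>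

definition real_spectrum :: "real^'m^'m \<Rightarrow> real set" where
  "real_spectrum B = {c. \<exists>v. v \<noteq> 0 \<and> B *v v = c *\<^sub>R v}"

text \<open>The block matrix \<open>[q, Q]\<close>. Its columns are indexed by \<open>'m option\<close>, where the index
  \<open>None\<close> stands for the column \<open>q\<close>.\<close>

definition prepend_col :: "real^'n \<Rightarrow> real^'m^'n \<Rightarrow> real^('m option)^'n" where
  "prepend_col q Q = (\<chi> i j. case j of None \<Rightarrow> q $ i | Some l \<Rightarrow> Q $ i $ l)"

definition eic_dom :: "real^'n^'n \<Rightarrow> real^'n^'n \<Rightarrow> real^'n \<Rightarrow> (real^'n) set" where
  "eic_dom A M q = {x. mnorm M x = 1 \<and> minner M q x > 0 \<and> Rq A M x \<le> Rq A M q}"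

text \<open>The matrix \<open>I - q q\<^sup>T M\<close>; the type \<open>real^1^'n\<close> makes \<open>q\<close> a single column.\<close>

definition oblique_proj :: "real^'n^'n \<Rightarrow> real^'n \<Rightarrow> real^'n^'n" where
  "oblique_proj M q = mat 1 - (columnvector q :: real^1^'n) ** rowvector q ** M"

text \<open>One step \<open>(x, z) \<mapsto> (x', z')\<close>. It is a relation because the minimizer \<open>x'\<close> need not be
  unique.\<close>

definition eic_step ::
  "real^'n^'n \<Rightarrow> real^'n^'n \<Rightarrow> real^'n \<Rightarrow> real \<Rightarrow> real \<Rightarrow>
     real^'n \<Rightarrow> real^'n \<Rightarrow> real^'n \<Rightarrow> real^'n \<Rightarrow> bool" where
  "eic_step A M q \<mu> \<tau> x z x' z' \<longleftrightarrow>
     (\<exists>\<eta>1 \<eta>2 xb r. \<eta>1 > 0 \<and> \<eta>2 > 0 \<and>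
        xb = (1 / \<eta>1) *\<^sub>R ((1 / minner M q x) *\<^sub>R x + (\<tau> / minner M q z) *\<^sub>R z) \<and>
        mnorm M xb = 1 \<and>
        r = 2 *\<^sub>R (A *v xb - Rq A M xb *\<^sub>R (M *v xb)) \<and>
        z' = (1 / \<eta>2) *\<^sub>R
               (((1 - \<tau>) / minner M q z) *\<^sub>R z + (\<tau> / minner M q xb) *\<^sub>R xb
                - (\<tau> * minner M q xb / \<mu>) *\<^sub>R (oblique_proj M q *v (matrix_inv M *v r))) \<and>
        mnorm M z' = 1 \<and>
        is_arg_min (Rq A M)
          (\<lambda>y. y \<in> eic_dom A M q \<inter> span {q, x, xb, matrix_inv M *v r}) x')"

definition eic_iteration ::
  "real^'n^'n \<Rightarrow> real^'n^'n \<Rightarrow> real^'n \<Rightarrow> real \<Rightarrow> real \<Rightarrow>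
     (nat \<Rightarrow> real^'n) \<Rightarrow> (nat \<Rightarrow> real^'n) \<Rightarrow> bool" where
  "eic_iteration A M q \<mu> \<tau> x z \<longleftrightarrow>
     x 0 \<in> eic_dom A M q \<and> z 0 \<in> eic_dom A M q \<and>
     (\<forall>k. eic_step A M q \<mu> \<tau> (x k) (z k) (x (Suc k)) (z (Suc k)))"

end

theory Submission
  imports Defs
begin

text \<open>Dividing a vector \<open>x\<close> by \<open>q\<^sup>T M x\<close> and writing the result as \<open>q + Q y\<close> turns the Rayleigh quotient
  into a rational function \<open>f\<close> of \<open>y\<close> with denominator \<open>1 + \<parallel>y\<parallel>\<^sup>2\<close>, and the iteration into Nesterov's
  accelerated gradient method for \<open>f\<close>, the optimal \<open>x\<close> being at least as good as a gradient step of
  length \<open>1 / L\<close>. Although \<open>f\<close> is not convex, its increments have exact expressions, for instance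
  \<open>(1 + \<parallel>y\<parallel>\<^sup>2) (f y - \<lambda>\<^sub>1) = d \<bullet> (B d - \<lambda>\<^sub>1 d)\<close> and
  \<open>(1 + \<parallel>y\<parallel>\<^sup>2) (\<nabla>f y \<bullet> d) = 2 (f y - \<lambda>\<^sub>1) (1 + y \<bullet> y\<^sub>*)\<close> with \<open>d = y - y\<^sub>*\<close>, \<open>y\<^sub>*\<close> the minimizer.
  They yield, on the ball of squared radius \<open>(\<rho> - \<lambda>\<^sub>1) / (2 L)\<close> around \<open>y\<^sub>*\<close>, the instances of strong convexity
  and smoothness that the decrease of \<open>E = f y - \<lambda>\<^sub>1 + \<mu> / 2 \<parallel>z - y\<^sub>*\<parallel>\<^sup>2\<close> by the factor \<open>1 - \<tau>\<close> needs. The bound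
  on \<open>Rq x\<^sub>0\<close> gives \<open>E \<le> (\<rho> - \<lambda>\<^sub>1) / (4 \<kappa>)\<close>, which keeps all iterates in this ball.\<close>

section \<open>The Rayleigh quotient on an affine slice\<close>

text \<open>The Rayleigh quotient, at the vector \<open>(1, y)\<close>, of the bordered matrix with
  corner \<open>rho\<close>, border \<open>b\<close> and block \<open>B\<close>.\<close>

definition rayleigh :: "('a::real_inner \<Rightarrow> 'a) \<Rightarrow> 'a \<Rightarrow> real \<Rightarrow> 'a \<Rightarrow> real" where
  "rayleigh B b rho y = (rho + 2 * (b \<bullet> y) + y \<bullet> B y) / (1 + y \<bullet> y)"

text \<open>The gradient of \<open>rayleigh\<close> by the quotient rule, for self-adjoint
  \<open>B\<close>. The exact identity \<open>f_increment\<close> takes the place of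
  differentiability.\<close>

definition rayleigh_grad :: "('a::real_inner \<Rightarrow> 'a) \<Rightarrow> 'a \<Rightarrow> real \<Rightarrow> 'a \<Rightarrow> 'a" where
  "rayleigh_grad B b rho y = (2 / (1 + y \<bullet> y)) *\<^sub>R (b + B y - rayleigh B b rho y *\<^sub>R y)"

text \<open>The last two assumptions say that \<open>(1, ys)\<close> is an eigenvector of the
  bordered matrix for the eigenvalue \<open>lam\<close>. That \<open>ys\<close> minimizes comes
  later, from a positive lower bound on \<open>B - lam\<close>.\<close>

locale rayleigh_chart =
  fixes B :: "'a::real_inner \<Rightarrow> 'a" and b :: 'a and rho lam :: real and ys :: 'a
  assumes lin: "linear B"
    and selfadj: "\<And>x y. B x \<bullet> y = x \<bullet> B y"
    and ys_eq: "b + B ys = lam *\<^sub>R ys"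
    and rho_eq: "rho + b \<bullet> ys = lam"
begin

abbreviation f :: "'a \<Rightarrow> real" where "f \<equiv> rayleigh B b rho"

abbreviation g :: "'a \<Rightarrow> 'a" where "g \<equiv> rayleigh_grad B b rho"

lemma den_pos: "0 < 1 + y \<bullet> (y::'a)"
  by (simp add: add_pos_nonneg)

lemma f_num: "(1 + y \<bullet> y) * f y = rho + 2 * (b \<bullet> y) + y \<bullet> B y"
  using den_pos[of y] by (simp add: rayleigh_def)

lemma g_num: "(1 + y \<bullet> y) * (g y \<bullet> d) = 2 * (b \<bullet> d + B y \<bullet> d - f y * (y \<bullet> d))"
  using den_pos[of y] by (simp add: rayleigh_grad_def inner_add_left inner_diff_left)

lemma g_scaled: "((1 + y \<bullet> y) / 2) *\<^sub>R g y = b + B y - f y *\<^sub>R y"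
proof -
  have "c / 2 * (2 / c) = 1" if "0 < c" for c :: real using that by simp
  from this[OF den_pos[of y]] show ?thesis by (simp only: rayleigh_grad_def scaleR_scaleR scaleR_one)
qed

lemma b_eq: "b = lam *\<^sub>R ys - B ys"
  using ys_eq by (simp add: algebra_simps)

text \<open>The left side is the quadratic form of the bordered matrix minus \<open>lam\<close> at
  \<open>(1, y)\<close>. That matrix annihilates \<open>(1, ys)\<close>, so the argument may be
  replaced by \<open>(0, y - ys)\<close>.\<close>

lemma f_gap: "(1 + y \<bullet> y) * (f y - lam) = (y - ys) \<bullet> (B (y - ys) - lam *\<^sub>R (y - ys))"
proof -
  have r: "rho = lam - lam * (ys \<bullet> ys) + ys \<bullet> B ys"
    using rho_eq by (simp add: b_eq inner_diff_left selfadj)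
  have s: "B ys \<bullet> y = ys \<bullet> B y" "y \<bullet> B ys = ys \<bullet> B y" "y \<bullet> ys = ys \<bullet> y"
    by (simp add: selfadj, metis selfadj inner_commute, simp add: inner_commute)
  have "(1 + y \<bullet> y) * (f y - lam) = rho + 2 * (b \<bullet> y) + y \<bullet> B y - lam * (1 + y \<bullet> y)"
    by (simp add: right_diff_distrib f_num)
  also have "\<dots> = (y - ys) \<bullet> (B (y - ys) - lam *\<^sub>R (y - ys))"
    by (simp add: r b_eq linear_diff[OF lin] inner_diff_left inner_diff_right s algebra_simps)
  finally show ?thesis .
qed

text \<open>Numerator minus \<open>f y\<close> times denominator is a quadratic polynomial, expanded
  here exactly around \<open>y\<close>: its constant term vanishes and its linear term is the scaled
  gradient.\<close>

lemma f_increment: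
  "(1 + (y + d) \<bullet> (y + d)) * (f (y + d) - f y)
     = (1 + y \<bullet> y) * (g y \<bullet> d) + d \<bullet> (B d - f y *\<^sub>R d)"
proof -
  have s: "B y \<bullet> d = d \<bullet> B y" "y \<bullet> B d = d \<bullet> B y" "y \<bullet> d = d \<bullet> y"
    by (simp add: inner_commute, metis selfadj inner_commute, simp add: inner_commute)
  have "(1 + (y + d) \<bullet> (y + d)) * (f (y + d) - f y)
     = rho + 2 * (b \<bullet> (y + d)) + (y + d) \<bullet> B (y + d) - f y * (1 + (y + d) \<bullet> (y + d))"
    by (simp add: right_diff_distrib f_num)
  also have "\<dots> = (rho + 2 * (b \<bullet> y) + y \<bullet> B y - (1 + y \<bullet> y) * f y)
     + 2 * (b \<bullet> d + B y \<bullet> d - f y * (y \<bullet> d)) + d \<bullet> (B d - f y *\<^sub>R d)"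
    by (simp add: linear_add[OF lin] inner_add_left inner_add_right inner_diff_right s algebra_simps)
  also have "\<dots> = (1 + y \<bullet> y) * (g y \<bullet> d) + d \<bullet> (B d - f y *\<^sub>R d)"
    by (simp only: f_num g_num)
  finally show ?thesis .
qed

lemma g_decomp:
  "((1 + y \<bullet> y) / 2) *\<^sub>R g y = (B (y - ys) - f y *\<^sub>R (y - ys)) - (f y - lam) *\<^sub>R ys"
  unfolding g_scaled by (subst b_eq) (simp add: linear_diff[OF lin] algebra_simps)

lemma f_ys: "f ys = lam"
  using f_gap[of ys] den_pos[of ys] by (simp add: linear_0[OF lin])

text \<open>\<open>f_increment\<close> along \<open>ys - y\<close> ends at the known value
  \<open>lam\<close>, and \<open>f_gap\<close> evaluates its quadratic term; what remains determines
  the gradient term.\<close>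

lemma g_inner_gap: "(1 + y \<bullet> y) * (g y \<bullet> (y - ys)) = 2 * (f y - lam) * (1 + y \<bullet> ys)"
proof -
  have "(1 + ys \<bullet> ys) * (lam - f y) = - ((1 + y \<bullet> y) * (g y \<bullet> (y - ys)))
       + (y - ys) \<bullet> (B (y - ys) - f y *\<^sub>R (y - ys))"
    using f_increment[of y "ys - y"]
    by (simp add: f_ys linear_diff[OF lin] inner_diff_left inner_diff_right algebra_simps)
  moreover have "(y - ys) \<bullet> (B (y - ys) - f y *\<^sub>R (y - ys))
      = (1 + y \<bullet> y) * (f y - lam) - (f y - lam) * ((y - ys) \<bullet> (y - ys))"
    unfolding f_gap by (simp add: inner_diff_right algebra_simps)
  moreover have "(y - ys) \<bullet> (y - ys) = y \<bullet> y - 2 * (y \<bullet> ys) + ys \<bullet> ys"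
    by (simp add: inner_diff_left inner_diff_right inner_commute)
  ultimately show ?thesis by (simp add: algebra_simps)
qed

end


section \<open>Positive semidefinite operators bounded by a constant\<close>

lemma semidefinite_square_le:
  fixes S :: "'a::real_inner \<Rightarrow> 'a"
  assumes S: "linear S" and sa: "\<And>x y. S x \<bullet> y = x \<bullet> S y"
    and pos: "\<And>x. 0 \<le> x \<bullet> S x" and le: "\<And>x. x \<bullet> S x \<le> C * (x \<bullet> x)" and C: "0 < C"
  shows "S d \<bullet> S d \<le> C * (d \<bullet> S d)"
proof -
  \<comment> \<open>In spectral terms the claim is \<open>S (C - S) \<ge> 0\<close>. Positivity at
    this \<open>w\<close> together with the upper bound at \<open>S d\<close> yields it without
    diagonalization.\<close>
  define w where "w = d - (1 / C) *\<^sub>R S d"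
  have "w \<bullet> S w = d \<bullet> S d - 2 / C * (S d \<bullet> S d) + (1 / C)\<^sup>2 * (S d \<bullet> S (S d))"
    unfolding w_def linear_diff[OF S] linear_cmul[OF S]
    by (simp add: inner_diff_left inner_diff_right sa[symmetric, of d "S d"] inner_commute[of "S d" d]
        power2_eq_square algebra_simps)
  also have "\<dots> \<le> d \<bullet> S d - 2 / C * (S d \<bullet> S d) + (1 / C)\<^sup>2 * (C * (S d \<bullet> S d))"
    using le[of "S d"] by (intro add_left_mono mult_left_mono) auto
  also have "\<dots> = d \<bullet> S d - (S d \<bullet> S d) / C"
    using C by (simp add: power2_eq_square field_simps)
  finally have "(S d \<bullet> S d) / C \<le> d \<bullet> S d"
    using pos[of w] by linarith
  then show ?thesis using C by (simp add: field_simps)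
qed

lemma semidefinite_norm_le:
  fixes S :: "'a::real_inner \<Rightarrow> 'a"
  assumes S: "linear S" and sa: "\<And>x y. S x \<bullet> y = x \<bullet> S y"
    and pos: "\<And>x. 0 \<le> x \<bullet> S x" and le: "\<And>x. x \<bullet> S x \<le> C * (x \<bullet> x)" and C: "0 < C"
  shows "norm (S d) \<le> C * norm d"
proof -
  have "S d \<bullet> S d \<le> C * (d \<bullet> S d)"
    by (rule semidefinite_square_le[OF assms])
  also have "\<dots> \<le> C * (C * (d \<bullet> d))"
    using le C by (intro mult_left_mono) auto
  finally have "(norm (S d))\<^sup>2 \<le> (C * norm d)\<^sup>2"
    by (simp add: power_mult_distrib power2_norm_eq_inner) (simp add: power2_eq_square)
  then show ?thesis using C by (simp add: power2_le_iff_abs_le)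
qed

section \<open>Accelerated gradient descent near the minimizer\<close>

text \<open>Instantiated with \<open>p = \<lambda>\<^sub>2 - \<rho>\<close>, \<open>m = \<xi>\<^sub>m\<^sub>i\<^sub>n - \<lambda>\<^sub>1\<close>, \<open>X = \<xi>\<^sub>m\<^sub>a\<^sub>x - \<lambda>\<^sub>1\<close>, \<open>eps = \<rho> - \<lambda>\<^sub>1\<close>;
  \<open>W = (\<chi> \<xi>\<^sub>m\<^sub>i\<^sub>n / \<lambda>\<^sub>2) eps\<close> is the curvature error contained in \<open>\<mu>\<close> and \<open>L\<close>.\<close>

locale eic_bounds = rayleigh_chart +
  fixes p m X eps mu L W :: real
  assumes quad_lower: "\<And>d. m * (d \<bullet> d) \<le> d \<bullet> (B d - lam *\<^sub>R d)"
    and quad_upper: "\<And>d. d \<bullet> (B d - lam *\<^sub>R d) \<le> X * (d \<bullet> d)"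
    and p_pos: "0 < p" and p_le_m: "p \<le> m" and m_le_X: "m \<le> X"
    and eps_nonneg: "0 \<le> eps" and eps_le: "17 * eps \<le> p"
    and ys_le: "p * (ys \<bullet> ys) \<le> eps"
    and mu_pos: "0 < mu" and mu_le: "mu * p \<le> 2 * m * (p - 16 * eps)"
    and L_ge: "2 * X + 2 * W \<le> L"
    and W_nonneg: "0 \<le> W" and W_ge: "60 * X * eps\<^sup>2 \<le> W\<^sup>2 * p" and W_le: "17 * W \<le> 18 * m"
begin

lemma gap_lower: "m * (norm (y - ys))\<^sup>2 \<le> (1 + y \<bullet> y) * (f y - lam)"
  using quad_lower[of "y - ys"] by (simp only: f_gap power2_norm_eq_inner)

lemma gap_upper: "(1 + y \<bullet> y) * (f y - lam) \<le> X * (norm (y - ys))\<^sup>2"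
  using quad_upper[of "y - ys"] by (simp only: f_gap power2_norm_eq_inner)

lemma gap_nonneg: "lam \<le> f y"
proof -
  have "0 \<le> (1 + y \<bullet> y) * (f y - lam)"
    by (rule order_trans[OF _ gap_lower]) (use p_pos p_le_m in auto)
  then show ?thesis using den_pos[of y] by (simp add: zero_le_mult_iff)
qed

lemma gap_le: "f y - lam \<le> X * (norm (y - ys))\<^sup>2"
proof -
  have "1 * (f y - lam) \<le> (1 + y \<bullet> y) * (f y - lam)"
    using gap_nonneg[of y] by (intro mult_right_mono) auto
  then show ?thesis using gap_upper[of y] by simp
qed

lemma den_le: "1 + y \<bullet> y \<le> 1 + 2 * (norm ys)\<^sup>2 + 2 * (norm (y - ys))\<^sup>2"
proof -
  have "norm y \<le> norm ys + norm (y - ys)" by norm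
  then have "(norm y)\<^sup>2 \<le> (norm ys + norm (y - ys))\<^sup>2" by (intro power_mono) auto
  also have "\<dots> \<le> 2 * (norm ys)\<^sup>2 + 2 * (norm (y - ys))\<^sup>2"
    using zero_le_power2[of "norm ys - norm (y - ys)"] by (simp add: power2_eq_square algebra_simps)
  finally show ?thesis by (simp add: power2_norm_eq_inner)
qed

lemma norm_ys_le: "p * (norm ys)\<^sup>2 \<le> eps"
  using ys_le by (simp add: power2_norm_eq_inner)

text \<open>\<open>gap_lower\<close> loses the factor \<open>D\<close>. A small gap forces
  \<open>D (p - 16 eps) \<le> p\<close>, a loss for which the margin \<open>16 eps\<close> in
  \<open>mu_le\<close> compensates.\<close>

lemma growth:
  assumes "f y - lam \<le> eps / 8"
  shows "mu / 2 * (norm (y - ys))\<^sup>2 \<le> f y - lam"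
proof -
  define D G s where "D = 1 + y \<bullet> y" "G = f y - lam" "s = (norm (y - ys))\<^sup>2"
  have D: "1 \<le> D" and G: "0 \<le> G" "G \<le> eps / 8" and s: "0 \<le> s"
    using assms gap_nonneg[of y] by (auto simp: D_G_s_def)
  have ms: "m * s \<le> D * G" using gap_lower[of y] by (simp add: D_G_s_def)
  have "p * s \<le> m * s" using p_le_m s by (simp add: mult_right_mono)
  also have "\<dots> \<le> D * (eps / 8)" using ms G D mult_left_mono[of G "eps / 8" D] by linarith
  finally have ps: "p * s \<le> D * eps / 8" by simp
  have "p * D \<le> p * (1 + 2 * (norm ys)\<^sup>2 + 2 * s)"
    using den_le[of y] p_pos by (simp add: D_G_s_def)
  then have "p * D \<le> p + 2 * eps + D * eps / 4"
    using ps norm_ys_le by (simp add: algebra_simps)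
  \<comment> \<open>\<open>D\<close> stands on both sides of the previous bound; replacing
    \<open>eps\<close> by \<open>D eps\<close> lets all error terms be collected on the
    left.\<close>
  moreover have "1 * eps \<le> D * eps" using D eps_nonneg by (intro mult_right_mono) auto
  ultimately have key: "D * (p - 16 * eps) \<le> p"
    using eps_nonneg by (simp add: algebra_simps)
  have "mu * s * p \<le> 2 * (m * s) * (p - 16 * eps)"
    using mult_right_mono[OF mu_le s] by (simp add: algebra_simps)
  also have "\<dots> \<le> 2 * (D * G) * (p - 16 * eps)"
    using ms eps_le eps_nonneg by (intro mult_right_mono) auto
  also have "\<dots> = 2 * G * (D * (p - 16 * eps))" by simp
  also have "\<dots> \<le> 2 * G * p" using key G by (intro mult_left_mono) auto
  finally have "mu * s \<le> 2 * G" using p_pos by simp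
  then show ?thesis by (simp add: D_G_s_def)
qed

lemma L_pos: "0 < L"
  using L_ge W_nonneg p_pos p_le_m m_le_X by linarith

section \<open>The ball around the minimizer and estimates on it\<close>

definition r :: real where "r = sqrt (eps / (2 * L))"

text \<open>Since \<open>L \<ge> 2 X\<close>, this radius gives \<open>X r^2 \<le> eps / 4\<close>,
  so the gap is at most \<open>eps / 4\<close> on the ball.\<close>

definition near :: "'a \<Rightarrow> bool" where
  "near y \<longleftrightarrow> norm (y - ys) \<le> r"

lemma r_nonneg: "0 \<le> r" and r_square: "2 * L * r\<^sup>2 = eps"
  using eps_nonneg L_pos by (auto simp: r_def)

lemma nearI: "2 * L * (norm (y - ys))\<^sup>2 \<le> eps \<Longrightarrow> near y"
  using L_pos unfolding near_def r_def by (intro real_le_rsqrt) (simp add: field_simps)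

lemma near_square: "near y \<Longrightarrow> (norm (y - ys))\<^sup>2 \<le> r\<^sup>2"
  unfolding near_def by (intro power_mono) auto

lemma X_pos: "0 < X"
  using p_pos p_le_m m_le_X by linarith

lemma X_r: "4 * X * r\<^sup>2 \<le> eps"
  using L_ge W_nonneg mult_right_mono[of "4 * X" "2 * L" "r\<^sup>2"] r_square by simp

lemma near_X: "near y \<Longrightarrow> 4 * X * (norm (y - ys))\<^sup>2 \<le> eps"
  by (rule order_trans[OF mult_left_mono X_r]) (use near_square X_pos in auto)

lemma near_p: "near y \<Longrightarrow> 4 * p * (norm (y - ys))\<^sup>2 \<le> eps"
  using near_X[of y] p_le_m m_le_X mult_right_mono[of "4 * p" "4 * X" "(norm (y - ys))\<^sup>2"]
  by simp

lemma near_gap: "near y \<Longrightarrow> f y - lam \<le> eps / 4"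
  using near_X[of y] gap_le[of y] by simp

text \<open>By \<open>g_inner_gap\<close> and polarization, \<open>D\<close> times the right side is
  \<open>G D + G (1 + t - s)\<close>. It remains to show
  \<open>mu s D \<le> 2 G (1 + t - s)\<close>; with \<open>m s \<le> D G\<close> this becomes a
  bound on \<open>D^2\<close>, paid for by the margin in \<open>mu_le\<close>.\<close>

lemma strong_convexity_at_minimizer:
  assumes "near y"
  shows "f y - lam + mu / 2 * (norm (y - ys))\<^sup>2 \<le> g y \<bullet> (y - ys)"
proof -
  define D G s t where "D = 1 + y \<bullet> y" "G = f y - lam" "s = (norm (y - ys))\<^sup>2" "t = (norm ys)\<^sup>2"
  note defs = D_G_s_t_def
  have D: "1 \<le> D" and G: "0 \<le> G" and s: "0 \<le> s" and t: "0 \<le> t"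
    using gap_nonneg[of y] by (auto simp: defs)
  have ms: "m * s \<le> D * G" using gap_lower[of y] by (simp add: defs)
  have ps: "4 * p * s \<le> eps" using near_p[OF assms] by (simp add: defs)
  have pt: "p * t \<le> eps" using norm_ys_le by (simp add: defs)
  have "2 * (y \<bullet> ys) = y \<bullet> y + t - s"
    by (simp add: defs power2_norm_eq_inner inner_diff_left inner_diff_right inner_commute)
  then have "2 * (1 + y \<bullet> ys) = D + (1 + t - s)" by (simp add: D_G_s_t_def(1))
  then have "G * (2 * (1 + y \<bullet> ys)) = G * (D + (1 + t - s))" by simp
  then have e: "2 * G * (1 + y \<bullet> ys) = G * D + G * (1 + t - s)"
    by (simp only: distrib_left mult.assoc mult.left_commute)
  have pD: "p * D \<le> p + 5 / 2 * eps"
  proof -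
    have "p * D \<le> p * (1 + 2 * t + 2 * s)"
      using den_le[of y] p_pos by (simp add: defs)
    then show ?thesis using ps pt by (simp add: algebra_simps)
  qed
  have "p * D \<le> p * (6 / 5)" using pD eps_le p_pos by linarith
  then have D2: "D \<le> 6 / 5" using p_pos by simp
  have "D * D * p \<le> D * (p + 5 / 2 * eps)" using mult_left_mono[OF pD, of D] D by (simp add: mult_ac)
  also have "\<dots> = p * D + 5 / 2 * eps * D" by (simp add: algebra_simps)
  also have "\<dots> \<le> (p + 5 / 2 * eps) + 5 / 2 * eps * (6 / 5)"
    using pD D2 eps_nonneg by (intro add_mono mult_left_mono) auto
  finally have DD: "D * D * p \<le> p + 11 / 2 * eps" by simp
  have "1 * eps \<le> D * D * eps" using D eps_nonneg
    by (intro mult_right_mono) (auto intro: order_trans[OF _ mult_mono[of 1 D 1 D]])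
  moreover have "D * D * (p - 16 * eps) = D * D * p - 16 * (D * D * eps)"
    "p * (1 + t - s) = p + p * t - p * s"
    by (simp_all add: algebra_simps)
  moreover have "0 \<le> p * t" using p_pos t by simp
  ultimately have key: "D * D * (p - 16 * eps) \<le> p * (1 + t - s)"
    using DD ps eps_nonneg by linarith
  have "mu * s * D * p = (mu * p) * (s * D)" by simp
  also have "\<dots> \<le> (2 * m * (p - 16 * eps)) * (s * D)"
    using mu_le s D by (intro mult_right_mono) auto
  also have "\<dots> = 2 * D * (m * s) * (p - 16 * eps)" by simp
  also have "\<dots> \<le> 2 * D * (D * G) * (p - 16 * eps)"
    using ms eps_le eps_nonneg D by (intro mult_right_mono mult_left_mono) auto
  also have "\<dots> = 2 * G * (D * D * (p - 16 * eps))" by simp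
  also have "\<dots> \<le> 2 * G * (p * (1 + t - s))" using key G by (intro mult_left_mono) auto
  finally have "p * (mu * s * D) \<le> p * (2 * G * (1 + t - s))" by (simp add: algebra_simps)
  then have "mu * s * D \<le> 2 * G * (1 + t - s)" using p_pos by simp
  then have "D * (G + mu / 2 * s) \<le> G * D + G * (1 + t - s)"
    by (simp add: algebra_simps)
  also have "\<dots> = D * (g y \<bullet> (y - ys))"
    using g_inner_gap[of y] e by (simp add: defs)
  finally have "G + mu / 2 * s \<le> g y \<bullet> (y - ys)" using D by simp
  then show ?thesis by (simp add: defs)
qed

text \<open>From \<open>W_ge\<close> and \<open>p \<le> X\<close>, with 60 rounded down to the
  square 49.\<close>

lemma seven_eps_le_W: "7 * eps \<le> W"
proof -
  have "49 * eps\<^sup>2 * p \<le> 60 * eps\<^sup>2 * X"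
    using p_le_m m_le_X p_pos by (intro mult_mono) auto
  also have "\<dots> = 60 * X * eps\<^sup>2" by simp
  also have "\<dots> \<le> W\<^sup>2 * p" by (rule W_ge)
  finally have "49 * eps\<^sup>2 \<le> W\<^sup>2" using p_pos by (rule mult_right_le_imp_le)
  then have "(7 * eps)\<^sup>2 \<le> W\<^sup>2" by (simp add: power_mult_distrib)
  then show ?thesis by (rule power2_le_imp_le) (rule W_nonneg)
qed

lemma X_r_r: "X * r * r \<le> W / 28"
  using X_r seven_eps_le_W by (simp add: power2_eq_square)

text \<open>The square is at most \<open>X eps^2 / (4 p)\<close>, the quantity controlled by
  \<open>W_ge\<close>; the resulting \<open>1 / 240\<close> is weakened to
  \<open>1 / 15^2\<close>.\<close>

lemma X_r_ys: "X * r * norm ys \<le> W / 15"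
proof -
  let ?t = "norm ys"
  have "(X * r * ?t)\<^sup>2 * p = X * ((X * r\<^sup>2) * (p * ?t\<^sup>2))"
    by (simp add: power_mult_distrib power2_eq_square)
  also have "\<dots> \<le> X * ((eps / 4) * eps)"
    using X_r norm_ys_le X_pos eps_nonneg p_pos
    by (intro mult_left_mono mult_mono) auto
  also have "\<dots> = (60 * X * eps\<^sup>2) / 240" by (simp add: power2_eq_square)
  also have "\<dots> \<le> W\<^sup>2 * p / 225"
  proof -
    have "0 \<le> W\<^sup>2 * p" using p_pos by simp
    then show ?thesis using W_ge by linarith
  qed
  also have "\<dots> = (W / 15)\<^sup>2 * p" by (simp add: power_divide)
  finally have "(X * r * ?t)\<^sup>2 \<le> (W / 15)\<^sup>2" using p_pos by (rule mult_right_le_imp_le)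
  then show ?thesis by (rule power2_le_imp_le) (use W_nonneg in simp)
qed

text \<open>In \<open>g_decomp\<close> the operator \<open>B - f y\<close> is positive and bounded
  by \<open>X\<close>, because the gap lies below \<open>m\<close>. The term along \<open>ys\<close>
  adds at most a fraction \<open>1 / 34\<close>, and \<open>2 * 35 / 34\<close> is rounded up to
  \<open>21 / 10\<close>.\<close>

lemma grad_norm_le:
  assumes "near y"
  shows "norm (g y) \<le> 21 / 10 * X * r"
proof -
  define d where "d = y - ys"
  let ?s = "norm d" and ?t = "norm ys"
  note X = X_pos
  have G: "0 \<le> f y - lam" "f y - lam \<le> eps / 4"
    using gap_nonneg[of y] near_gap[OF assms] by auto
  then have Gm: "f y - lam < m" using eps_le p_le_m p_pos by linarith
  define C where "C = X - (f y - lam)"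
  have C: "0 < C" "C \<le> X" using Gm m_le_X G by (auto simp: C_def)
  have op: "norm (B d - f y *\<^sub>R d) \<le> C * ?s"
  proof (rule semidefinite_norm_le[where S="\<lambda>d. B d - f y *\<^sub>R d"])
    show "linear (\<lambda>d. B d - f y *\<^sub>R d)"
      by (intro linear_compose_sub lin linear_compose_scale_right linear_id[unfolded id_def])
    show "(B v - f y *\<^sub>R v) \<bullet> w = v \<bullet> (B w - f y *\<^sub>R w)" for v w
      by (simp add: inner_diff_left inner_diff_right selfadj)
    have q: "v \<bullet> (B v - f y *\<^sub>R v) = v \<bullet> (B v - lam *\<^sub>R v) - (f y - lam) * (v \<bullet> v)" for v
      by (simp add: inner_diff_right algebra_simps)
    show "0 \<le> v \<bullet> (B v - f y *\<^sub>R v)" for v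
      using quad_lower[of v] Gm mult_right_mono[of "f y - lam" m "v \<bullet> v"] unfolding q by simp
    show "v \<bullet> (B v - f y *\<^sub>R v) \<le> C * (v \<bullet> v)" for v
      using quad_upper[of v] unfolding q C_def by (simp add: algebra_simps)
  qed (rule C)
  \<comment> \<open>\<open>1 / 34\<close> is the root of \<open>1 / 68 * 1 / 17\<close>; these bound
    the squared norms by \<open>near_p\<close>, \<open>norm_ys_le\<close> and
    \<open>17 * eps \<le> p\<close>.\<close>
  have st: "?s * ?t \<le> 1 / 34"
  proof (rule power2_le_imp_le)
    have "p * ?s\<^sup>2 \<le> p * (1 / 68)" "p * ?t\<^sup>2 \<le> p * (1 / 17)"
      using near_p[OF assms] norm_ys_le eps_le by (auto simp: d_def)
    then have "?s\<^sup>2 \<le> 1 / 68" "?t\<^sup>2 \<le> 1 / 17" using p_pos by (auto simp only: mult_le_cancel_left_pos)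
    then have "?s\<^sup>2 * ?t\<^sup>2 \<le> (1 / 68) * (1 / 17)" by (intro mult_mono) auto
    then show "(?s * ?t)\<^sup>2 \<le> (1 / 34)\<^sup>2" by (simp add: power2_eq_square algebra_simps)
  qed simp
  have "1 / 2 * norm (g y) \<le> (1 + y \<bullet> y) / 2 * norm (g y)"
    by (intro mult_right_mono) auto
  also have "\<dots> = norm (((1 + y \<bullet> y) / 2) *\<^sub>R g y)"
    using den_pos[of y] by simp
  also have "\<dots> \<le> norm (B d - f y *\<^sub>R d) + norm ((f y - lam) *\<^sub>R ys)"
    unfolding g_decomp d_def by (rule norm_triangle_ineq4)
  also have "\<dots> \<le> C * ?s + (X * ?s\<^sup>2) * ?t"
    using op G gap_le[of y] by (intro add_mono) (auto simp: d_def intro!: mult_right_mono)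
  also have "\<dots> \<le> X * ?s + X * ?s * (?s * ?t)"
    using mult_right_mono[OF C(2), of ?s] by (simp add: power2_eq_square mult.assoc)
  also have "\<dots> \<le> X * ?s + X * ?s * (1 / 34)"
    using st X by (intro add_left_mono mult_left_mono) auto
  also have "\<dots> = 35 / 34 * (X * ?s)" by simp
  finally have "norm (g y) \<le> 35 / 17 * (X * ?s)" by simp
  also have "\<dots> \<le> 21 / 10 * (X * r)"
  proof -
    have "X * ?s \<le> X * r" "0 \<le> X * ?s"
      using X assms by (auto simp: d_def near_def)
    then show ?thesis by linarith
  qed
  finally show ?thesis by simp
qed

lemma near_norm_le: "near y \<Longrightarrow> norm y \<le> norm ys + r"
  unfolding near_def by norm

text \<open>In \<open>f_increment\<close> the gradient term carries the denominator at
  \<open>yb\<close> instead of \<open>y\<close>. The discrepancy is at most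
  \<open>|g yb| (2 |yb| + |d|) |d|^2\<close>, and on the ball the gradient is small enough for the
  curvature \<open>m - (f yb - lam)\<close> to dominate it.\<close>

lemma near_convexity:
  assumes nb: "near yb" and ny: "near y"
  shows "g yb \<bullet> (y - yb) \<le> f y - f yb"
proof -
  define d where "d = y - yb"
  let ?t = "norm ys"
  have nd: "norm d \<le> 2 * r" using nb ny unfolding near_def d_def by norm
  have "norm (g yb) * (2 * norm yb + norm d) \<le> (21 / 10 * X * r) * (2 * (?t + r) + 2 * r)"
    using grad_norm_le[OF nb] near_norm_le[OF nb] nd X_pos r_nonneg by (intro mult_mono) auto
  also have "\<dots> = 42 / 10 * (X * r * ?t) + 84 / 10 * (X * r * r)"
    by (simp add: algebra_simps)
  also have "\<dots> \<le> 42 / 10 * (W / 15) + 84 / 10 * (W / 28)"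
    using X_r_ys X_r_r by (intro add_mono mult_left_mono) auto
  \<comment> \<open>The sum is \<open>29 / 50 * W\<close>, below \<open>5 / 8 * m\<close> by
    \<open>W_le\<close>, while the gap is at most \<open>m / 68\<close>.\<close>
  also have "\<dots> \<le> m - (f yb - lam)"
    using W_le near_gap[OF nb] eps_le p_le_m p_pos by simp
  finally have c: "norm (g yb) * (2 * norm yb + norm d) \<le> m - (f yb - lam)" .
  have "(2 * (yb \<bullet> d) + d \<bullet> d) * (g yb \<bullet> d) \<le> \<bar>2 * (yb \<bullet> d) + d \<bullet> d\<bar> * \<bar>g yb \<bullet> d\<bar>"
    by (metis abs_ge_self abs_mult)
  also have "\<dots> \<le> (2 * (norm yb * norm d) + norm d * norm d) * (norm (g yb) * norm d)"
  proof (rule mult_mono)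
    show "\<bar>2 * (yb \<bullet> d) + d \<bullet> d\<bar> \<le> 2 * (norm yb * norm d) + norm d * norm d"
      using Cauchy_Schwarz_ineq2[of yb d] Cauchy_Schwarz_ineq2[of d d] by linarith
  qed (auto intro: Cauchy_Schwarz_ineq2)
  also have "\<dots> = norm (g yb) * (2 * norm yb + norm d) * (d \<bullet> d)"
    by (simp add: power2_norm_eq_inner[symmetric] power2_eq_square algebra_simps)
  also have "\<dots> \<le> (m - (f yb - lam)) * (d \<bullet> d)" using c by (intro mult_right_mono) auto
  also have "\<dots> \<le> d \<bullet> (B d - f yb *\<^sub>R d)"
    using quad_lower[of d] by (simp add: inner_diff_right algebra_simps)
  also have "\<dots> = (1 + y \<bullet> y) * (f y - f yb) - (1 + yb \<bullet> yb) * (g yb \<bullet> d)"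
    using f_increment[of yb d] by (simp add: d_def)
  finally have "(1 + yb \<bullet> yb + (2 * (yb \<bullet> d) + d \<bullet> d)) * (g yb \<bullet> d) \<le> (1 + y \<bullet> y) * (f y - f yb)"
    by (simp add: algebra_simps)
  moreover have "1 + yb \<bullet> yb + (2 * (yb \<bullet> d) + d \<bullet> d) = 1 + y \<bullet> y"
    by (simp add: d_def inner_diff_left inner_diff_right inner_commute)
  ultimately have "(1 + y \<bullet> y) * (g yb \<bullet> d) \<le> (1 + y \<bullet> y) * (f y - f yb)" by simp
  then have "g yb \<bullet> d \<le> f y - f yb"
    using den_pos[of y] by (simp only: mult_le_cancel_left_pos)
  then show ?thesis by (simp add: d_def)
qed

text \<open>\<open>f_increment\<close> along \<open>- g y / L\<close>. In
  \<open>L \<ge> 2 X + 2 W\<close> the first part pays for the curvature and the second for the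
  change of the denominator.\<close>

lemma gradient_step_descent:
  assumes ny: "near y"
  shows "f (y - (1 / L) *\<^sub>R g y) \<le> f y - (norm (g y))\<^sup>2 / (2 * L)"
proof -
  define d where "d = - ((1 / L) *\<^sub>R g y)"
  define G where "G = (norm (g y))\<^sup>2"
  let ?t = "norm ys"
  have G0: "0 \<le> G" by (simp add: G_def)
  have gd: "g y \<bullet> d = - G / L" and dd: "d \<bullet> d = G / L\<^sup>2"
    unfolding G_def power2_norm_eq_inner by (simp_all add: d_def power2_eq_square)
  have "norm y * norm (g y) \<le> (?t + r) * (21 / 10 * X * r)"
    using grad_norm_le[OF ny] near_norm_le[OF ny] r_nonneg by (intro mult_mono) auto
  also have "\<dots> = 21 / 10 * (X * r * ?t) + 21 / 10 * (X * r * r)" by (simp add: algebra_simps)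
  also have "\<dots> \<le> 21 / 10 * (W / 15) + 21 / 10 * (W / 28)"
    using X_r_ys X_r_r by (intro add_mono mult_left_mono) auto
  finally have yg: "norm y * norm (g y) \<le> 43 / 200 * W" using W_nonneg by simp
  have "G \<le> (21 / 10 * X * r)\<^sup>2"
    unfolding G_def using grad_norm_le[OF ny] by (intro power_mono) auto
  also have "\<dots> = 441 / 100 * (X * r * r) * X" by (simp add: power2_eq_square)
  also have "\<dots> \<le> 441 / 100 * (W / 28) * L"
    using X_r_r X_pos L_ge W_nonneg r_nonneg by (intro mult_mono) auto
  also have "\<dots> = 441 / 2800 * (W * L)" by simp
  also have "\<dots> \<le> 1 * (W * L)"
    using W_nonneg L_pos by (intro mult_right_mono) auto
  finally have GL: "G / L \<le> W" using L_pos by (simp add: pos_divide_le_eq)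
  have "2 * X + G / L - 2 * (y \<bullet> g y) \<le> L * 1"
    using yg GL L_ge W_nonneg Cauchy_Schwarz_ineq2[of y "g y"] by simp
  also have "\<dots> \<le> L * (1 + y \<bullet> y)" using L_pos by (intro mult_left_mono) auto
  finally have key: "2 * X + G / L - 2 * (y \<bullet> g y) - L * (1 + y \<bullet> y) \<le> 0" by simp
  \<comment> \<open>Splits off the target decrease times the new denominator, so that the remainder
    has the sign of \<open>key\<close>. Here \<open>D\<close> is the old denominator and
    \<open>c\<close> is \<open>y \<bullet> g y\<close>.\<close>
  have split: "- D * G / l + X * (G / l\<^sup>2)
      = (D - 2 * c / l + G / l\<^sup>2) * (- G / (2 * l))
        + G / (2 * l\<^sup>2) * (2 * X + G / l - 2 * c - l * D)" if "0 < l" for D c l :: real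
  proof -
    define i where "i = 1 / l"
    have e: "a / l = a * i" "a / l\<^sup>2 = a * i\<^sup>2" "a / (2 * l) = a * i / 2"
      "a / (2 * l\<^sup>2) = a * i\<^sup>2 / 2" for a by (simp_all add: i_def power_divide)
    have "l * i = 1" using that by (simp add: i_def)
    then show ?thesis unfolding e by algebra
  qed
  have den: "1 + (y + d) \<bullet> (y + d) = 1 + y \<bullet> y - 2 * (y \<bullet> g y) / L + G / L\<^sup>2"
    by (simp add: inner_add_left inner_add_right dd[symmetric])
       (simp add: d_def inner_commute)
  have "(1 + (y + d) \<bullet> (y + d)) * (f (y + d) - f y)
      = - (1 + y \<bullet> y) * G / L + d \<bullet> (B d - f y *\<^sub>R d)"
    unfolding f_increment gd by (simp only: minus_mult_left minus_mult_right times_divide_eq_right)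
  also have "d \<bullet> (B d - f y *\<^sub>R d) \<le> X * (d \<bullet> d)"
    using quad_upper[of d] gap_nonneg[of y] mult_right_mono[of lam "f y" "d \<bullet> d"]
    by (simp add: inner_diff_right)
  also have "- (1 + y \<bullet> y) * G / L + X * (d \<bullet> d)
      = (1 + (y + d) \<bullet> (y + d)) * (- G / (2 * L))
        + G / (2 * L\<^sup>2) * (2 * X + G / L - 2 * (y \<bullet> g y) - L * (1 + y \<bullet> y))"
    unfolding den dd by (rule split[OF L_pos])
  also have "\<dots> \<le> (1 + (y + d) \<bullet> (y + d)) * (- G / (2 * L))"
    using mult_nonneg_nonpos[OF _ key, of "G / (2 * L\<^sup>2)"] G0 by simp
  finally have "f (y + d) - f y \<le> - G / (2 * L)"
    using den_pos[of "y + d"] by (simp only: mult_le_cancel_left_pos)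
  then show ?thesis by (simp add: d_def G_def)
qed

text \<open>Since \<open>\<tau> w = \<tau> (yb - ys) + (1 - \<tau>) (yb - y)\<close> for \<open>w = (1 - \<tau>) (z - ys) + \<tau> (yb - ys)\<close>,
  the cross term of \<open>\<parallel>w - (\<tau> / \<mu>) g\<parallel>\<^sup>2\<close> is controlled by the two convexity inequalities at \<open>yb\<close>.\<close>

lemma lyapunov_step:
  assumes ny: "near y" and nb: "near yb"
    and tau: "0 < \<tau>" "\<tau> \<le> 1" "\<tau>\<^sup>2 * L \<le> mu"
    and yb: "(1 + \<tau>) *\<^sub>R yb = y + \<tau> *\<^sub>R z"
    and z': "z' = (1 - \<tau>) *\<^sub>R z + \<tau> *\<^sub>R yb - (\<tau> / mu) *\<^sub>R g yb"
    and y': "f y' \<le> f yb - (norm (g yb))\<^sup>2 / (2 * L)"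
  shows "f y' - lam + mu / 2 * (norm (z' - ys))\<^sup>2
     \<le> (1 - \<tau>) * (f y - lam + mu / 2 * (norm (z - ys))\<^sup>2)"
proof -
  define G where "G = (norm (g yb))\<^sup>2"
  define a c where "a = z - ys" and "c = yb - ys"
  define w where "w = (1 - \<tau>) *\<^sub>R a + \<tau> *\<^sub>R c"
  have tw: "\<tau> *\<^sub>R w = \<tau> *\<^sub>R (yb - ys) + (1 - \<tau>) *\<^sub>R (yb - y)"
  proof -
    have tz: "\<tau> *\<^sub>R z = (1 + \<tau>) *\<^sub>R yb - y" using yb by simp
    have "\<tau> *\<^sub>R w = (1 - \<tau>) *\<^sub>R (\<tau> *\<^sub>R z) - (\<tau> * (1 - \<tau>)) *\<^sub>R ys + (\<tau> * \<tau>) *\<^sub>R (yb - ys)"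
      by (simp add: w_def a_def c_def algebra_simps)
    then show ?thesis unfolding tz by (simp add: algebra_simps)
  qed
  have w2: "(norm w)\<^sup>2 \<le> (1 - \<tau>) * (norm a)\<^sup>2 + \<tau> * (norm c)\<^sup>2"
  proof -
    have "(norm w)\<^sup>2 = (1 - \<tau>) * (norm a)\<^sup>2 + \<tau> * (norm c)\<^sup>2 - \<tau> * (1 - \<tau>) * (norm (a - c))\<^sup>2"
      by (simp add: w_def power2_norm_eq_inner inner_add_left inner_add_right inner_diff_left
          inner_diff_right inner_commute algebra_simps)
    moreover have "0 \<le> \<tau> * (1 - \<tau>) * (norm (a - c))\<^sup>2" using tau by simp
    ultimately show ?thesis by linarith
  qed
  have z'w: "z' - ys = w - (\<tau> / mu) *\<^sub>R g yb"
    by (simp add: z' w_def a_def c_def algebra_simps)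
  have "(norm (z' - ys))\<^sup>2 = (norm w)\<^sup>2 - 2 * (\<tau> / mu) * (g yb \<bullet> w) + (\<tau> / mu)\<^sup>2 * G"
    unfolding z'w G_def power2_norm_eq_inner
    by (simp add: inner_diff_left inner_diff_right inner_commute power2_eq_square algebra_simps)
  moreover have "mu / 2 * (n - 2 * (\<tau> / mu) * i + (\<tau> / mu)\<^sup>2 * G)
      = mu / 2 * n - \<tau> * i + \<tau>\<^sup>2 / (2 * mu) * G" for n i
    using mu_pos by (simp add: power2_eq_square right_diff_distrib distrib_left)
  ultimately have "mu / 2 * (norm (z' - ys))\<^sup>2
      = mu / 2 * (norm w)\<^sup>2 - g yb \<bullet> (\<tau> *\<^sub>R w) + \<tau>\<^sup>2 / (2 * mu) * G"
    by (simp only: inner_scaleR_right)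
  also have "\<dots> \<le> mu / 2 * ((1 - \<tau>) * (norm a)\<^sup>2 + \<tau> * (norm c)\<^sup>2)
      - (\<tau> * (f yb - lam + mu / 2 * (norm c)\<^sup>2) + (1 - \<tau>) * (f yb - f y)) + G / (2 * L)"
  proof (intro add_mono diff_mono mult_left_mono)
    have "\<tau> * (f yb - lam + mu / 2 * (norm c)\<^sup>2) \<le> \<tau> * (g yb \<bullet> (yb - ys))"
      using strong_convexity_at_minimizer[OF nb] tau by (simp add: c_def)
    moreover have "f yb - f y \<le> g yb \<bullet> (yb - y)"
      using near_convexity[OF nb ny] by (simp add: inner_diff_right)
    then have "(1 - \<tau>) * (f yb - f y) \<le> (1 - \<tau>) * (g yb \<bullet> (yb - y))"
      using tau by (intro mult_left_mono) auto
    ultimately show "\<tau> * (f yb - lam + mu / 2 * (norm c)\<^sup>2) + (1 - \<tau>) * (f yb - f y)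
        \<le> g yb \<bullet> (\<tau> *\<^sub>R w)"
      unfolding tw by (simp only: inner_add_right inner_scaleR_right)
    \<comment> \<open>The step-size bound enters here: the quadratic term in the gradient does not
      exceed the gain of the descent step.\<close>
    have "\<tau>\<^sup>2 / (2 * mu) * G \<le> 1 / (2 * L) * G"
      using tau mu_pos L_pos by (intro mult_right_mono) (auto simp: G_def field_simps)
    then show "\<tau>\<^sup>2 / (2 * mu) * G \<le> G / (2 * L)" by simp
  qed (use w2 mu_pos in auto)
  finally show ?thesis using y' by (simp add: G_def a_def algebra_simps diff_divide_distrib)
qed

lemma mu_le_L: "mu \<le> L"
proof -
  have "mu * p \<le> 2 * m * p"
    by (rule order_trans[OF mu_le mult_left_mono]) (use p_pos p_le_m eps_nonneg in auto)
  then have "mu \<le> 2 * m" using p_pos by simp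
  then show ?thesis using L_ge W_nonneg m_le_X by linarith
qed

text \<open>The descent hypothesis on \<open>Y\<close> is conditional because the minimizer in the
  iteration competes only with points of level at most \<open>lam + eps\<close>, the level of
  \<open>q\<close>. The proof verifies this level for each gradient step.\<close>

theorem accelerated_convergence:
  fixes Y Z Yb :: "nat \<Rightarrow> 'a"
  assumes tau: "0 < \<tau>" "\<tau>\<^sup>2 * L \<le> mu"
    and init: "Z 0 = Y 0" "8 * L * (f (Y 0) - lam) \<le> eps * mu"
    and Yb: "\<And>k. (1 + \<tau>) *\<^sub>R Yb k = Y k + \<tau> *\<^sub>R Z k"
    and Z: "\<And>k. Z (Suc k) = (1 - \<tau>) *\<^sub>R Z k + \<tau> *\<^sub>R Yb k - (\<tau> / mu) *\<^sub>R g (Yb k)"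
    and mono: "\<And>k. f (Y (Suc k)) \<le> f (Y k)"
    and Y: "\<And>k. f (Yb k - (1 / L) *\<^sub>R g (Yb k)) \<le> lam + eps \<Longrightarrow>
               f (Y (Suc k)) \<le> f (Yb k - (1 / L) *\<^sub>R g (Yb k))"
  shows "f (Y k) - lam \<le> 2 * (1 - \<tau>) ^ k * (f (Y 0) - lam)"
proof -
  have tau1: "\<tau> \<le> 1"
  proof -
    have "\<tau>\<^sup>2 * L \<le> 1 * L" using tau mu_le_L by simp
    then have "\<tau>\<^sup>2 \<le> 1" using L_pos by (simp only: mult_le_cancel_right_pos)
    then show ?thesis by (simp add: power2_le_iff_abs_le abs_square_le_1)
  qed
  have f0: "f (Y 0) - lam \<le> eps / 8"
  proof -
    have "mu * (8 * (f (Y 0) - lam)) \<le> L * (8 * (f (Y 0) - lam))"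
      using mu_le_L gap_nonneg[of "Y 0"] by (intro mult_right_mono) auto
    also have "\<dots> \<le> mu * eps" using init by (simp add: algebra_simps)
    finally show ?thesis using mu_pos by simp
  qed
  have fk: "f (Y k) \<le> f (Y 0)" for k
    by (induction k) (auto intro: order_trans[OF mono])
  \<comment> \<open>The initial bound is calibrated so that energy at most
    \<open>2 (f (Y 0) - lam)\<close> forces membership in the ball.\<close>
  have nearI_mu: "near v" if "mu / 2 * (norm (v - ys))\<^sup>2 \<le> 2 * (f (Y 0) - lam)" for v
  proof (rule nearI)
    have "mu * (2 * L * (norm (v - ys))\<^sup>2) = 4 * L * (mu / 2 * (norm (v - ys))\<^sup>2)" by simp
    also have "\<dots> \<le> 4 * L * (2 * (f (Y 0) - lam))"
      using that L_pos by (intro mult_left_mono) auto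
    also have "\<dots> \<le> mu * eps" using init by (simp add: algebra_simps)
    finally show "2 * L * (norm (v - ys))\<^sup>2 \<le> eps" using mu_pos by simp
  qed
  have nY: "near (Y k)" for k
    using growth[of "Y k"] fk[of k] f0 gap_nonneg[of "Y 0"] by (intro nearI_mu) auto
  define E where "E k = f (Y k) - lam + mu / 2 * (norm (Z k - ys))\<^sup>2" for k
  \<comment> \<open>As \<open>Z 0 = Y 0\<close>, \<open>growth\<close> bounds the second part of
    \<open>E 0\<close> by the first; this is the source of the factor 2 in the conclusion.\<close>
  have E0: "E 0 \<le> 2 * (f (Y 0) - lam)"
    using growth[OF f0] by (simp add: E_def init)
  have "E k \<le> (1 - \<tau>) ^ k * E 0" for k
  proof (induction k)
    case (Suc k)
    have En: "0 \<le> E 0" using gap_nonneg[of "Y 0"] mu_pos by (simp add: E_def)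
    \<comment> \<open>The energy bound at \<open>k\<close> puts \<open>Z k\<close>, and then the
      convex combination \<open>Yb k\<close>, into the ball, where the local inequalities are
      available.\<close>
    have "(1 - \<tau>) ^ k * E 0 \<le> 1 * E 0"
      using tau tau1 En by (intro mult_right_mono power_le_one) auto
    then have "mu / 2 * (norm (Z k - ys))\<^sup>2 \<le> 2 * (f (Y 0) - lam)"
      using Suc E0 gap_nonneg[of "Y k"] unfolding E_def[of k] by linarith
    then have nZ: "near (Z k)" by (rule nearI_mu)
    have "(1 + \<tau>) *\<^sub>R (Yb k - ys) = (Y k - ys) + \<tau> *\<^sub>R (Z k - ys)"
      using Yb[of k] by (simp add: algebra_simps)
    then have "(1 + \<tau>) * norm (Yb k - ys) = norm ((Y k - ys) + \<tau> *\<^sub>R (Z k - ys))"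
      using tau by (metis abs_of_pos add_pos_pos norm_scaleR zero_less_one)
    also have "\<dots> \<le> norm (Y k - ys) + \<tau> * norm (Z k - ys)"
      using tau norm_triangle_ineq[of "Y k - ys" "\<tau> *\<^sub>R (Z k - ys)"] by simp
    also have "\<dots> \<le> r + \<tau> * r"
      using nY[of k] nZ tau by (intro add_mono mult_left_mono) (auto simp: near_def)
    also have "\<dots> = (1 + \<tau>) * r" by (simp add: algebra_simps)
    finally have nb: "near (Yb k)" using tau by (simp add: near_def)
    note desc = gradient_step_descent[OF nb]
    have "0 \<le> (norm (g (Yb k)))\<^sup>2 / (2 * L)" using L_pos by simp
    then have "f (Yb k - (1 / L) *\<^sub>R g (Yb k)) \<le> lam + eps"
      using desc near_gap[OF nb] eps_nonneg by linarith
    from order_trans[OF Y[OF this] desc]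
    have "E (Suc k) \<le> (1 - \<tau>) * E k"
      unfolding E_def by (intro lyapunov_step[OF nY nb tau(1) tau1 tau(2) Yb Z])
    also have "\<dots> \<le> (1 - \<tau>) * ((1 - \<tau>) ^ k * E 0)"
      using Suc tau1 by (intro mult_left_mono) auto
    finally show ?case by simp
  qed simp
  from this[of k] have "E k \<le> (1 - \<tau>) ^ k * (2 * (f (Y 0) - lam))"
    using E0 tau1 mult_left_mono[OF E0, of "(1 - \<tau>) ^ k"] by simp
  moreover have "0 \<le> mu / 2 * (norm (Z k - ys))\<^sup>2" using mu_pos by simp
  ultimately have "f (Y k) - lam \<le> (1 - \<tau>) ^ k * (2 * (f (Y 0) - lam))"
    unfolding E_def by linarith
  then show ?thesis by (simp only: mult.assoc mult.left_commute)
qed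

end

section \<open>Symmetric matrices and pencils\<close>

lemma symmetric_inner:
  fixes A :: "real^'n^'n"
  assumes "transpose A = A"
  shows "(A *v x) \<bullet> y = x \<bullet> (A *v y)"
  by (metis assms dot_lmul_matrix vector_transpose_matrix)

lemma transpose_inner:
  fixes Q :: "real^'m^'n"
  shows "(transpose Q *v x) \<bullet> y = x \<bullet> (Q *v y)"
  by (metis dot_lmul_matrix transpose_transpose vector_transpose_matrix)

section \<open>Extreme eigenvalues of a symmetric matrix\<close>

lemma selfadjoint_max_eigenvector:
  fixes S :: "'a::euclidean_space \<Rightarrow> 'a"
  assumes S: "linear S" and sa: "\<And>x y. S x \<bullet> y = x \<bullet> S y"
  shows "\<exists>v. norm v = 1 \<and> S v = (v \<bullet> S v) *\<^sub>R v \<and> (\<forall>w. w \<bullet> S w \<le> (v \<bullet> S v) * (w \<bullet> w))"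
proof -
  have cont: "continuous_on (sphere 0 1) (\<lambda>v. v \<bullet> S v)"
    using linear_continuous_on[OF S[unfolded linear_conv_bounded_linear]]
    by (rule continuous_on_inner[OF continuous_on_id])
  obtain e :: 'a where "norm e = 1" using vector_choose_size[of 1] by auto
  then have "e \<in> sphere 0 1" by simp
  then have "sphere (0::'a) 1 \<noteq> {}" by blast
  from continuous_attains_sup[OF compact_sphere this cont]
  obtain v where v: "v \<in> sphere 0 1" and max: "\<And>w. w \<in> sphere 0 1 \<Longrightarrow> w \<bullet> S w \<le> v \<bullet> S v"
    by blast
  define c where "c = v \<bullet> S v"
  have nv: "norm v = 1" using v by simp
  then have vv: "v \<bullet> v = 1" by (simp add: norm_eq_1)
  have le: "w \<bullet> S w \<le> c * (w \<bullet> w)" for w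
  proof (cases "w = 0")
    case False
    define e where "e = (1 / norm w) *\<^sub>R w"
    have "e \<bullet> S e \<le> c" using max[of e] False by (simp add: e_def c_def)
    moreover have "w \<bullet> S w = (norm w)\<^sup>2 * (e \<bullet> S e)"
      using False by (simp add: e_def linear_cmul[OF S] power2_eq_square)
    ultimately show ?thesis
      using mult_left_mono[of "e \<bullet> S e" c "(norm w)\<^sup>2"] by (simp add: power2_norm_eq_inner mult.commute)
  qed (simp add: linear_0[OF S])
  \<comment> \<open>\<open>T\<close> is positive semidefinite and its form vanishes at the maximizer
    \<open>v\<close>, so \<open>semidefinite_square_le\<close> forces
    \<open>T v = 0\<close>.\<close>
  define T where "T = (\<lambda>w. c *\<^sub>R w - S w)"
  have T: "linear T"
    unfolding T_def by (intro linear_compose_sub S linear_compose_scale_right linear_id[unfolded id_def])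
  have Tsa: "T x \<bullet> y = x \<bullet> T y" for x y
    by (simp add: T_def inner_diff_left inner_diff_right sa)
  have Tpos: "0 \<le> w \<bullet> T w" for w
    using le[of w] by (simp add: T_def inner_diff_right)
  obtain C where C: "0 < C" "\<And>w. norm (T w) \<le> C * norm w"
    using linear_bounded_pos[OF T] by blast
  have "w \<bullet> T w \<le> C * (w \<bullet> w)" for w
  proof -
    have "w \<bullet> T w \<le> norm w * norm (T w)" by (rule norm_cauchy_schwarz)
    also have "\<dots> \<le> norm w * (C * norm w)" by (intro mult_left_mono C) auto
    finally show ?thesis by (simp add: dot_square_norm power2_eq_square mult_ac)
  qed
  from semidefinite_square_le[OF T Tsa Tpos this C(1), of v]
  have "T v \<bullet> T v \<le> C * (v \<bullet> T v)" .
  also have "v \<bullet> T v = 0" by (simp add: T_def inner_diff_right vv c_def)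
  finally have "T v = 0" by (metis inner_gt_zero_iff mult_zero_right not_le)
  then have "S v = c *\<^sub>R v" by (simp add: T_def)
  then show ?thesis using nv le unfolding c_def by blast
qed

text \<open>Eigenvectors chosen for distinct eigenvalues are orthogonal, hence independent, and an
  independent set is finite.\<close>

lemma finite_real_spectrum:
  fixes B :: "real^'m^'m"
  assumes "transpose B = B"
  shows "finite (real_spectrum B)"
proof -
  define h where "h c = (SOME v. v \<noteq> 0 \<and> B *v v = c *\<^sub>R v)" for c
  have h: "h c \<noteq> 0" "B *v h c = c *\<^sub>R h c" if "c \<in> real_spectrum B" for c
    using that someI_ex[of "\<lambda>v. v \<noteq> 0 \<and> B *v v = c *\<^sub>R v"]
    unfolding real_spectrum_def h_def by blast+
  have orth: "h c \<bullet> h d = 0" if "c \<in> real_spectrum B" "d \<in> real_spectrum B" "c \<noteq> d" for c d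
  proof -
    have "c * (h c \<bullet> h d) = d * (h c \<bullet> h d)"
      using symmetric_inner[OF assms, of "h c" "h d"] h[OF that(1)] h[OF that(2)] by simp
    then show ?thesis using that(3) by simp
  qed
  have inj: "inj_on h (real_spectrum B)"
    by (rule inj_onI) (metis h(1) inner_eq_zero_iff orth)
  have "pairwise orthogonal (h ` real_spectrum B)"
    unfolding pairwise_def orthogonal_def using orth by blast
  moreover have "0 \<notin> h ` real_spectrum B" using h(1) by force
  ultimately have "independent (h ` real_spectrum B)"
    by (rule pairwise_orthogonal_independent)
  then have "finite (h ` real_spectrum B)" by (rule independent_imp_finite)
  then show ?thesis using inj finite_image_iff by blast
qed

lemma Max_real_spectrum:
  fixes B :: "real^'m^'m"
  assumes B: "transpose B = B"
  shows "w \<bullet> (B *v w) \<le> Max (real_spectrum B) * (w \<bullet> w)"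
    and "\<exists>v. norm v = 1 \<and> v \<bullet> (B *v v) = Max (real_spectrum B)"
proof -
  note fin = finite_real_spectrum[OF B]
  from selfadjoint_max_eigenvector[of "(*v) B", OF matrix_vector_mul_linear symmetric_inner[OF B]]
  obtain v where "norm v = 1 \<and> B *v v = (v \<bullet> (B *v v)) *\<^sub>R v \<and>
      (\<forall>w. w \<bullet> (B *v w) \<le> (v \<bullet> (B *v v)) * (w \<bullet> w))" ..
  then have v: "norm v = 1" "B *v v = (v \<bullet> (B *v v)) *\<^sub>R v"
      "\<And>w. w \<bullet> (B *v w) \<le> (v \<bullet> (B *v v)) * (w \<bullet> w)" by blast+
  have mem: "v \<bullet> (B *v v) \<in> real_spectrum B"
  proof -
    have "v \<noteq> 0" using v(1) by auto
    then show ?thesis using v(2) unfolding real_spectrum_def by blast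
  qed
  have "c \<le> v \<bullet> (B *v v)" if c: "c \<in> real_spectrum B" for c
  proof -
    obtain w where w: "w \<noteq> 0" "B *v w = c *\<^sub>R w" using c unfolding real_spectrum_def by blast
    then show ?thesis using v(3)[of w] by simp
  qed
  then have e: "Max (real_spectrum B) = v \<bullet> (B *v v)" by (intro Max_eqI fin mem)
  show "w \<bullet> (B *v w) \<le> Max (real_spectrum B) * (w \<bullet> w)"
    unfolding e by (rule v(3))
  show "\<exists>v. norm v = 1 \<and> v \<bullet> (B *v v) = Max (real_spectrum B)"
    unfolding e using v(1) by blast
qed

text \<open>An eigenvector attaining the maximum for \<open>- B\<close> attains the minimum for
  \<open>B\<close>.\<close>

lemma Min_real_spectrum:
  fixes B :: "real^'m^'m"
  assumes B: "transpose B = B"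
  shows "Min (real_spectrum B) * (w \<bullet> w) \<le> w \<bullet> (B *v w)"
    and "\<exists>v. norm v = 1 \<and> v \<bullet> (B *v v) = Min (real_spectrum B)"
proof -
  note fin = finite_real_spectrum[OF B]
  have neg: "linear (\<lambda>v. - (B *v v))"
    by (intro linear_compose_neg matrix_vector_mul_linear)
  have neg_sa: "- (B *v x) \<bullet> y = x \<bullet> - (B *v y)" for x y
    using symmetric_inner[OF B] by simp
  from selfadjoint_max_eigenvector[OF neg neg_sa]
  obtain v where "norm v = 1 \<and> - (B *v v) = (v \<bullet> - (B *v v)) *\<^sub>R v \<and>
      (\<forall>w. w \<bullet> - (B *v w) \<le> (v \<bullet> - (B *v v)) * (w \<bullet> w))" ..
  then have v: "norm v = 1" "- (B *v v) = (v \<bullet> - (B *v v)) *\<^sub>R v"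
      "\<And>w. w \<bullet> - (B *v w) \<le> (v \<bullet> - (B *v v)) * (w \<bullet> w)" by blast+
  have mem: "v \<bullet> (B *v v) \<in> real_spectrum B"
  proof -
    have "v \<noteq> 0" using v(1) by auto
    moreover have "B *v v = (v \<bullet> (B *v v)) *\<^sub>R v"
      using v(2) by (metis inner_minus_right neg_equal_iff_equal scaleR_minus_left)
    ultimately show ?thesis unfolding real_spectrum_def by blast
  qed
  have "v \<bullet> (B *v v) \<le> c" if c: "c \<in> real_spectrum B" for c
  proof -
    obtain w where w: "w \<noteq> 0" "B *v w = c *\<^sub>R w" using c unfolding real_spectrum_def by blast
    then show ?thesis using v(3)[of w] by simp
  qed
  then have e: "Min (real_spectrum B) = v \<bullet> (B *v v)" by (intro Min_eqI fin mem)
  show "Min (real_spectrum B) * (w \<bullet> w) \<le> w \<bullet> (B *v w)"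
    unfolding e using v(3)[of w] by simp
  show "\<exists>v. norm v = 1 \<and> v \<bullet> (B *v v) = Min (real_spectrum B)"
    unfolding e using v(1) by blast
qed

section \<open>Orthonormal frames and spectral bounds of the pencil\<close>

lemma congruence_right_inverse:
  fixes P :: "real^'k^'n" and M :: "real^'n^'n"
  assumes card: "CARD('k) = CARD('n)" and P: "transpose P ** M ** P = mat 1"
  shows "P *v (transpose P *v (M *v v)) = v"
proof -
  have inv: "transpose P *v (M *v (P *v w)) = w" for w
    using P by (metis matrix_vector_mul_assoc matrix_vector_mul_lid)
  have inj: "inj ((*v) P)"
    by (rule inj_on_inverseI) (rule inv)
  \<comment> \<open>\<open>P\<close> has the left inverse \<open>transpose P ** M\<close>. Equal
    cardinality of the two index types makes \<open>P\<close> onto, so this inverse is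
    two-sided.\<close>
  have "dim (range ((*v) P)) = CARD('n)"
    using dim_image_eq[OF matrix_vector_mul_linear, of P UNIV] inj card by (simp add: inj_on_subset)
  then have "range ((*v) P) = UNIV"
    by (metis DIM_cart DIM_real dim_eq_full mult.right_neutral span_eq_iff subspace_UNIV
        linear_subspace_image matrix_vector_mul_linear)
  then obtain w where "v = P *v w" by (metis surjE)
  then show ?thesis by (simp only: inv)
qed

lemma matrix_inv_cancel:
  fixes M :: "real^'n^'n"
  assumes "sym_pos_def M"
  shows "M *v (matrix_inv M *v v) = v"
proof -
  have "inj ((*v) M)"
  proof (rule injI)
    fix x y assume "M *v x = M *v y"
    then have "M *v (x - y) = 0" by (simp add: matrix_vector_mult_diff_distrib)
    then have "(x - y) \<bullet> (M *v (x - y)) = 0" by simp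
    then show "x = y" using assms unfolding sym_pos_def_def by (metis less_irrefl right_minus_eq)
  qed
  then obtain N where "N ** M = mat 1"
    using matrix_left_invertible_injective[of M] by (auto simp: inj_def)
  then have "invertible M" using invertible_left_inverse by blast
  then have "M ** matrix_inv M = mat 1"
    unfolding invertible_def matrix_inv_def by (rule someI2_ex) blast
  then show ?thesis by (metis matrix_vector_mul_assoc matrix_vector_mul_lid)
qed

text \<open>After reindexing by \<open>'n\<close>, the \<open>u i\<close> are the columns of a
  matrix \<open>U\<close> with \<open>transpose U ** M ** U = mat 1\<close>, and
  \<open>congruence_right_inverse\<close> applies.\<close>

lemma eigenvector_expansion:
  fixes M :: "real^'n^'n" and u :: "nat \<Rightarrow> real^'n"
  assumes orth: "\<And>i j. \<lbrakk>i \<in> {1..CARD('n)}; j \<in> {1..CARD('n)}; i \<noteq> j\<rbrakk> \<Longrightarrow> minner M (u i) (u j) = 0"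
    and u_norm: "\<And>i. i \<in> {1..CARD('n)} \<Longrightarrow> mnorm M (u i) = 1"
  shows "(\<Sum>i\<in>{1..CARD('n)}. minner M (u i) v *\<^sub>R u i) = v"
proof -
  obtain \<phi> :: "'n \<Rightarrow> nat" where \<phi>: "bij_betw \<phi> UNIV {1..CARD('n)}"
    using finite_same_card_bij[of "UNIV::'n set" "{1..CARD('n)}"] by auto
  define U :: "real^'n^'n" where "U = (\<chi> i j. u (\<phi> j) $ i)"
  have U: "U *v w = (\<Sum>j\<in>UNIV. w $ j *\<^sub>R u (\<phi> j))" for w
    by (simp add: U_def matrix_vector_mult_def vec_eq_iff mult.commute)
  have Ut: "(transpose U *v w) $ j = u (\<phi> j) \<bullet> w" for w j
    by (simp add: U_def transpose_def matrix_vector_mult_def inner_vec_def)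
  have mem: "\<phi> j \<in> {1..CARD('n)}" for j using \<phi> bij_betwE by blast
  have uu: "u (\<phi> i) \<bullet> (M *v u (\<phi> j)) = (if i = j then 1 else 0)" for i j
  proof (cases "i = j")
    case True
    then show ?thesis using u_norm[OF mem, of j] by (simp add: mnorm_def minner_def)
  next
    case False
    then have "\<phi> i \<noteq> \<phi> j" using \<phi> by (metis UNIV_I bij_betw_def inj_on_def)
    then show ?thesis using orth[OF mem mem] False by (simp add: minner_def)
  qed
  have "(transpose U *v (M *v (U *v w))) $ i = w $ i" for w i
  proof -
    have "(transpose U *v (M *v (U *v w))) $ i = (\<Sum>j\<in>UNIV. w $ j * (u (\<phi> i) \<bullet> (M *v u (\<phi> j))))"
      unfolding Ut U
      by (simp add: linear_sum[OF matrix_vector_mul_linear] inner_sum_right matrix_vector_mult_scaleR)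
    also have "\<dots> = w $ i" unfolding uu by (simp add: if_distrib[of "(*) _"] cong: if_cong)
    finally show ?thesis .
  qed
  then have "transpose U ** M ** U = mat 1"
    unfolding matrix_eq by (simp only: matrix_vector_mul_assoc[symmetric] vec_eq_iff matrix_vector_mul_lid) blast
  from congruence_right_inverse[OF _ this, of v]
  have "v = (\<Sum>j\<in>UNIV. minner M (u (\<phi> j)) v *\<^sub>R u (\<phi> j))"
    by (simp only: U Ut minner_def)
  also have "\<dots> = (\<Sum>i\<in>{1..CARD('n)}. minner M (u i) v *\<^sub>R u i)"
    by (rule sum.reindex_bij_betw[OF \<phi>])
  finally show ?thesis by simp
qed

text \<open>Both forms are diagonal in the coefficients \<open>c i\<close>. Subtracting
  \<open>lam 1\<close> removes the first index, and all others satisfy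
  \<open>lam i \<ge> lam 2\<close>.\<close>

lemma pencil_quadratic_bounds:
  fixes A M :: "real^'n^'n" and lam :: "nat \<Rightarrow> real" and u :: "nat \<Rightarrow> real^'n"
  assumes A: "transpose A = A" and M: "transpose M = M" and n: "2 \<le> CARD('n)"
    and gap: "lam 1 < lam 2" and mono: "mono_on {2..CARD('n)} lam"
    and eig: "\<And>i. i \<in> {1..CARD('n)} \<Longrightarrow> A *v u i = lam i *\<^sub>R (M *v u i)"
    and orth: "\<And>i j. \<lbrakk>i \<in> {1..CARD('n)}; j \<in> {1..CARD('n)}; i \<noteq> j\<rbrakk> \<Longrightarrow> minner M (u i) (u j) = 0"
    and u_norm: "\<And>i. i \<in> {1..CARD('n)} \<Longrightarrow> mnorm M (u i) = 1"
  shows "(lam 2 - lam 1) * (minner M v v - (minner M (u 1) v)\<^sup>2) \<le> minner A v v - lam 1 * minner M v v"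
    and "minner A v v \<le> lam CARD('n) * minner M v v"
proof -
  define c where "c i = minner M (u i) v" for i
  let ?I = "{1..CARD('n)}"
  have exp: "v = (\<Sum>i\<in>?I. c i *\<^sub>R u i)"
    unfolding c_def using eigenvector_expansion[where M=M and u=u and v=v] orth u_norm by simp
  have vM: "v \<bullet> (M *v u i) = c i" for i
    by (metis M c_def inner_commute minner_def symmetric_inner)
  have MM: "minner M v v = (\<Sum>i\<in>?I. (c i)\<^sup>2)"
  proof -
    have "minner M v v = v \<bullet> (M *v (\<Sum>i\<in>?I. c i *\<^sub>R u i))"
      using exp by (simp only: minner_def)
    also have "\<dots> = (\<Sum>i\<in>?I. (c i)\<^sup>2)"
      by (simp add: linear_sum[OF matrix_vector_mul_linear] inner_sum_right matrix_vector_mult_scaleR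
          vM power2_eq_square)
    finally show ?thesis .
  qed
  have AA: "minner A v v = (\<Sum>i\<in>?I. lam i * (c i)\<^sup>2)"
  proof -
    have "minner A v v = v \<bullet> (A *v (\<Sum>i\<in>?I. c i *\<^sub>R u i))"
      using exp by (simp only: minner_def)
    also have "\<dots> = (\<Sum>i\<in>?I. lam i * (c i)\<^sup>2)"
      unfolding linear_sum[OF matrix_vector_mul_linear] inner_sum_right
      by (rule sum.cong) (simp_all add: matrix_vector_mult_scaleR eig vM power2_eq_square mult_ac)
    finally show ?thesis .
  qed
  have ge2: "lam 2 \<le> lam i" if "i \<in> ?I - {1}" for i
    using that n mono_onD[OF mono, of 2 i] by simp
  have le: "lam i \<le> lam CARD('n)" if "i \<in> ?I" for i
  proof (cases "i = 1")
    case True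
    then show ?thesis using gap ge2[of "CARD('n)"] n by simp
  next
    case False
    then show ?thesis using that n mono_onD[OF mono, of i "CARD('n)"] by simp
  qed
  have 1: "1 \<in> ?I" using n by simp
  note split1 = sum.remove[OF finite_atLeastAtMost 1]
  have "(lam 2 - lam 1) * (minner M v v - (c 1)\<^sup>2) = (\<Sum>i\<in>?I - {1}. (lam 2 - lam 1) * (c i)\<^sup>2)"
    unfolding MM split1[of "\<lambda>i. (c i)\<^sup>2"] by (simp only: add_diff_cancel_left' sum_distrib_left)
  also have "\<dots> \<le> (\<Sum>i\<in>?I - {1}. (lam i - lam 1) * (c i)\<^sup>2)"
    using ge2 by (intro sum_mono mult_right_mono) auto
  also have "\<dots> = (\<Sum>i\<in>?I. (lam i - lam 1) * (c i)\<^sup>2)"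
    unfolding split1[of "\<lambda>i. (lam i - lam 1) * (c i)\<^sup>2"] by simp
  also have "\<dots> = minner A v v - lam 1 * minner M v v"
    by (simp add: AA MM left_diff_distrib sum_subtractf sum_distrib_left)
  finally show "(lam 2 - lam 1) * (minner M v v - (minner M (u 1) v)\<^sup>2) \<le> minner A v v - lam 1 * minner M v v"
    by (simp only: c_def)
  show "minner A v v \<le> lam CARD('n) * minner M v v"
    unfolding AA MM sum_distrib_left using le by (intro sum_mono mult_right_mono) auto
qed

section \<open>The iteration in frame coordinates\<close>

locale pencil_frame =
  fixes A M :: "real^'n^'n" and q :: "real^'n" and Q :: "real^'m^'n"
  assumes A_sym: "transpose A = A" and M_spd: "sym_pos_def M"
    and dim: "CARD('n) = CARD('m) + 1"
    and orthonormal: "transpose (prepend_col q Q) ** M ** prepend_col q Q = mat 1"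
begin

lemma M_sym: "transpose M = M"
  using M_spd by (simp add: sym_pos_def_def)

lemma prepend_col_mult: "prepend_col q Q *v w = w $ None *\<^sub>R q + Q *v (\<chi> l. w $ Some l)"
  by (simp add: prepend_col_def matrix_vector_mult_def vec_eq_iff UNIV_option_conv sum.reindex)

lemma prepend_col_transpose_mult:
  "(transpose (prepend_col q Q) *v x) $ None = q \<bullet> x"
  "(transpose (prepend_col q Q) *v x) $ Some l = (transpose Q *v x) $ l"
  by (simp_all add: prepend_col_def transpose_def matrix_vector_mult_def inner_vec_def)

lemma frame_expansion: "minner M q x *\<^sub>R q + Q *v (transpose Q *v (M *v x)) = x"
proof -
  have "CARD('m option) = CARD('n)" using dim by (simp add: card_option)
  from congruence_right_inverse[OF this orthonormal, of x]
  show ?thesis by (simp only: prepend_col_mult prepend_col_transpose_mult vec_lambda_eta minner_def)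
qed

lemma frame_coordinates:
  "q \<bullet> (M *v (c *\<^sub>R q + Q *v y)) = c"
  "transpose Q *v (M *v (c *\<^sub>R q + Q *v y)) = y"
proof -
  define w :: "real^'m option" where "w = (\<chi> j. case j of None \<Rightarrow> c | Some l \<Rightarrow> y $ l)"
  have P: "prepend_col q Q *v w = c *\<^sub>R q + Q *v y"
    by (simp add: prepend_col_mult w_def)
  have "transpose (prepend_col q Q) *v (M *v (prepend_col q Q *v w)) = w"
    using orthonormal by (metis matrix_vector_mul_assoc matrix_vector_mul_lid)
  then have e: "(transpose (prepend_col q Q) *v (M *v (c *\<^sub>R q + Q *v y))) $ j = w $ j" for j
    unfolding P by simp
  show "q \<bullet> (M *v (c *\<^sub>R q + Q *v y)) = c"
    using e[of None] unfolding prepend_col_transpose_mult by (simp add: w_def)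
  show "transpose Q *v (M *v (c *\<^sub>R q + Q *v y)) = y"
    unfolding vec_eq_iff prepend_col_transpose_mult(2)[symmetric] e by (simp add: w_def)
qed

section \<open>Coordinates on the slice of vectors with \<open>minner M q x = 1\<close>\<close>

definition chart :: "real^'m \<Rightarrow> real^'n" where
  "chart y = q + Q *v y"

text \<open>The inverse of \<open>chart\<close>, after \<open>x\<close> has been rescaled onto the
  slice.\<close>

definition coord :: "real^'n \<Rightarrow> real^'m" where
  "coord x = (1 / minner M q x) *\<^sub>R (transpose Q *v (M *v x))"

abbreviation "BQ \<equiv> transpose Q ** A ** Q"
abbreviation "bq \<equiv> transpose Q *v (A *v q)"
abbreviation "rho \<equiv> Rq A M q"
abbreviation "F \<equiv> rayleigh ((*v) BQ) bq rho"
abbreviation "G \<equiv> rayleigh_grad ((*v) BQ) bq rho"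

lemma q_M_chart: "q \<bullet> (M *v chart y) = 1"
  using frame_coordinates(1)[of 1 y] by (simp add: chart_def)

lemma Q_M_chart: "transpose Q *v (M *v chart y) = y"
  using frame_coordinates(2)[of 1 y] by (simp add: chart_def)

lemma chart_coord: "minner M q x \<noteq> 0 \<Longrightarrow> (1 / minner M q x) *\<^sub>R x = chart (coord x)"
  by (subst (2) frame_expansion[of x, symmetric])
    (simp add: chart_def coord_def matrix_vector_mult_scaleR scaleR_add_right)

lemma minner_scaled_chart: "minner M q (c *\<^sub>R chart y) = c"
  by (simp add: minner_def matrix_vector_mult_scaleR q_M_chart)

lemma coord_scaled_chart: "c \<noteq> 0 \<Longrightarrow> coord (c *\<^sub>R chart y) = y"
  unfolding coord_def minner_scaled_chart
  by (simp add: matrix_vector_mult_scaleR Q_M_chart del: transpose_matrix_vector)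

lemma minner_M_chart: "minner M (chart y) (chart y) = 1 + y \<bullet> y"
proof -
  have "minner M (chart y) (chart y) = q \<bullet> (M *v chart y) + (transpose Q *v (M *v chart y)) \<bullet> y"
    unfolding transpose_inner minner_def by (subst chart_def) (simp add: inner_add_left inner_commute)
  then show ?thesis by (simp only: q_M_chart Q_M_chart)
qed

lemma minner_q_q: "minner M q q = 1"
  using minner_M_chart[of 0] by (simp add: chart_def)

lemma Rq_q: "rho = q \<bullet> (A *v q)"
  by (simp add: Rq_def minner_q_q) (simp add: minner_def)

lemma Q_A_chart: "transpose Q *v (A *v chart y) = bq + BQ *v y"
  by (simp add: chart_def matrix_vector_right_distrib matrix_vector_mul_assoc[symmetric] del: vector_transpose_matrix)

lemma q_A_chart: "q \<bullet> (A *v chart y) = rho + bq \<bullet> y"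
  unfolding transpose_inner Rq_q
  by (simp add: chart_def matrix_vector_right_distrib inner_add_right symmetric_inner[OF A_sym])

lemma minner_A_chart: "minner A (chart y) (chart y) = rho + 2 * (bq \<bullet> y) + y \<bullet> (BQ *v y)"
proof -
  have "minner A (chart y) (chart y) = q \<bullet> (A *v chart y) + (transpose Q *v (A *v chart y)) \<bullet> y"
    unfolding transpose_inner minner_def by (subst chart_def) (simp add: inner_add_left inner_commute)
  also note q_A_chart
  finally show ?thesis
    unfolding Q_A_chart by (simp add: inner_add_left inner_add_right inner_commute)
qed

lemma Rq_chart: "Rq A M (chart y) = F y"
  unfolding Rq_def rayleigh_def minner_A_chart minner_M_chart ..

lemma Rq_scale: "c \<noteq> 0 \<Longrightarrow> Rq A M (c *\<^sub>R x) = Rq A M x"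
  by (simp add: Rq_def minner_def matrix_vector_mult_scaleR)

lemma Rq_coord: "minner M q x \<noteq> 0 \<Longrightarrow> Rq A M x = F (coord x)"
  using chart_coord[of x] Rq_scale[of "1 / minner M q x" x] Rq_chart[of "coord x"] by simp

text \<open>The chain rule for \<open>Rq\<close> along \<open>chart\<close> in algebraic form; it
  turns the residual of the iteration into the coordinate gradient.\<close>

lemma grad_eq:
  "((1 + y \<bullet> y) / 2) *\<^sub>R G y = transpose Q *v (A *v chart y - F y *\<^sub>R (M *v chart y))"
proof -
  have "c / 2 * (2 / c) = 1" if "0 < c" for c :: real using that by simp
  from this[of "1 + y \<bullet> y"] have c: "(1 + y \<bullet> y) / 2 * (2 / (1 + y \<bullet> y)) = 1"
    by (simp only: add_pos_nonneg[OF zero_less_one inner_ge_zero])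
  have "transpose Q *v (A *v chart y - F y *\<^sub>R (M *v chart y)) = bq + BQ *v y - F y *\<^sub>R y"
    by (simp only: matrix_vector_mult_diff_distrib matrix_vector_mult_scaleR Q_A_chart Q_M_chart)
  then show ?thesis by (simp only: rayleigh_grad_def scaleR_scaleR c scaleR_one)
qed

text \<open>By \<open>frame_expansion\<close> the projection keeps the part
  \<open>Q *v (transpose Q *v (M *v v))\<close> of a vector \<open>v\<close>; at
  \<open>v = matrix_inv M *v r\<close> the matrix \<open>M\<close> cancels.\<close>

lemma oblique_proj_inv: "oblique_proj M q *v (matrix_inv M *v r) = Q *v (transpose Q *v r)"
  and oblique_proj_mult: "oblique_proj M q *v x = x - minner M q x *\<^sub>R q"
proof -
  have outer: "(columnvector q :: real^1^'n) ** rowvector q *v w = (q \<bullet> w) *\<^sub>R q" for w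
    by (simp add: vec_eq_iff matrix_vector_mult_def matrix_matrix_mult_def columnvector_def
        rowvector_def inner_vec_def sum_distrib_left sum_distrib_right mult_ac)
  have assoc: "((columnvector q :: real^1^'n) ** rowvector q ** M) *v w
      = ((columnvector q :: real^1^'n) ** rowvector q) *v (M *v w)" for w
    by (simp only: matrix_vector_mul_assoc)
  show proj: "oblique_proj M q *v x = x - minner M q x *\<^sub>R q" for x
    by (simp only: oblique_proj_def matrix_vector_mult_diff_rdistrib matrix_vector_mul_lid
        assoc outer minner_def)
  show "oblique_proj M q *v (matrix_inv M *v r) = Q *v (transpose Q *v r)"
    using frame_expansion[of "matrix_inv M *v r"] unfolding proj matrix_inv_cancel[OF M_spd]
    by (metis add_diff_cancel_left')
qed

text \<open>\<open>coord\<close> is blind to the normalizations, so the step becomes the accelerated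
  scheme, \<open>yb\<close> being the coordinates of the averaged vector \<open>xb\<close>. The last
  claim compares \<open>x'\<close> with a gradient step of arbitrary length
  \<open>s\<close>.\<close>

lemma eic_step_chart:
  assumes step: "eic_step A M q mu \<tau> x z x' z'" and tau: "0 < \<tau>"
    and xd: "x \<in> eic_dom A M q" and qz: "0 < minner M q z"
    and yb: "(1 + \<tau>) *\<^sub>R yb = coord x + \<tau> *\<^sub>R coord z"
  shows "0 < minner M q z'"
    and "coord z' = (1 - \<tau>) *\<^sub>R coord z + \<tau> *\<^sub>R yb - (\<tau> / mu) *\<^sub>R G yb"
    and "x' \<in> eic_dom A M q" and "Rq A M x' \<le> Rq A M x"
    and "F (yb - s *\<^sub>R G yb) \<le> rho \<Longrightarrow> Rq A M x' \<le> F (yb - s *\<^sub>R G yb)"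
proof -
  obtain \<eta>1 \<eta>2 xb r where \<eta>: "\<eta>1 > 0" "\<eta>2 > 0"
    and xb: "xb = (1 / \<eta>1) *\<^sub>R ((1 / minner M q x) *\<^sub>R x + (\<tau> / minner M q z) *\<^sub>R z)"
    and nxb: "mnorm M xb = 1"
    and r: "r = 2 *\<^sub>R (A *v xb - Rq A M xb *\<^sub>R (M *v xb))"
    and z': "z' = (1 / \<eta>2) *\<^sub>R
               (((1 - \<tau>) / minner M q z) *\<^sub>R z + (\<tau> / minner M q xb) *\<^sub>R xb
                - (\<tau> * minner M q xb / mu) *\<^sub>R (oblique_proj M q *v (matrix_inv M *v r)))"
    and x': "is_arg_min (Rq A M)
          (\<lambda>y. y \<in> eic_dom A M q \<inter> span {q, x, xb, matrix_inv M *v r}) x'"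
    using step unfolding eic_step_def by blast
  let ?w = "matrix_inv M *v r"
  let ?S = "span {q, x, xb, ?w}"
  have qx: "0 < minner M q x" using xd by (simp add: eic_dom_def)
  have cx: "(1 / minner M q x) *\<^sub>R x = chart (coord x)"
    using qx by (intro chart_coord) simp
  have cz: "(c / minner M q z) *\<^sub>R z = c *\<^sub>R chart (coord z)" for c
    using chart_coord[of z] qz by (metis less_irrefl mult.right_neutral scaleR_scaleR times_divide_eq_right)
  define a where "a = (1 + \<tau>) / \<eta>1"
  have a: "0 < a" using \<eta> tau by (simp add: a_def)
  have "chart (coord x) + \<tau> *\<^sub>R chart (coord z) = (1 + \<tau>) *\<^sub>R q + Q *v (coord x + \<tau> *\<^sub>R coord z)"
    by (simp add: chart_def matrix_vector_right_distrib matrix_vector_mult_scaleR algebra_simps)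
  also have "\<dots> = (1 + \<tau>) *\<^sub>R chart yb"
    unfolding yb[symmetric] by (simp add: chart_def matrix_vector_mult_scaleR scaleR_add_right)
  finally have xb_a: "xb = a *\<^sub>R chart yb"
    unfolding xb cx cz by (simp add: a_def)
  have qxb: "minner M q xb = a" unfolding xb_a by (rule minner_scaled_chart)
  \<comment> \<open>One factor \<open>a\<close> comes from the residual, the other from
    \<open>minner M q xb\<close> in the update of \<open>z\<close>. Together they cancel
    \<open>1 + |yb|^2\<close> in \<open>grad_eq\<close> and leave exactly
    \<open>G yb\<close>.\<close>
  have aa: "a * a * (1 + yb \<bullet> yb) = 1"
  proof -
    have "minner M xb xb = 1" using nxb by (simp add: mnorm_def)
    moreover have "minner M xb xb = a * a * minner M (chart yb) (chart yb)"
      unfolding xb_a by (simp add: minner_def matrix_vector_mult_scaleR)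
    ultimately show ?thesis by (simp only: minner_M_chart)
  qed
  have Rxb: "Rq A M xb = F yb"
    unfolding xb_a using Rq_scale[of a "chart yb"] a by (simp add: Rq_chart)
  have "r = (2 * a) *\<^sub>R (A *v chart yb - F yb *\<^sub>R (M *v chart yb))"
    unfolding r Rxb unfolding xb_a by (simp add: matrix_vector_mult_scaleR algebra_simps)
  then have "transpose Q *v r = (2 * a) *\<^sub>R (((1 + yb \<bullet> yb) / 2) *\<^sub>R G yb)"
    unfolding grad_eq by (simp only: matrix_vector_mult_scaleR)
  then have "a *\<^sub>R (transpose Q *v r) = (a * a * (1 + yb \<bullet> yb)) *\<^sub>R G yb" by simp
  then have aQr: "a *\<^sub>R (transpose Q *v r) = G yb" unfolding aa by simp
  have QG: "Q *v G yb = a *\<^sub>R (Q *v (transpose Q *v r))"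
    unfolding aQr[symmetric] by (rule matrix_vector_mult_scaleR)
  have xbc: "(\<tau> / minner M q xb) *\<^sub>R xb = \<tau> *\<^sub>R chart yb"
    unfolding qxb unfolding xb_a using a by simp
  have z'_chart: "z' = (1 / \<eta>2) *\<^sub>R chart ((1 - \<tau>) *\<^sub>R coord z + \<tau> *\<^sub>R yb - (\<tau> / mu) *\<^sub>R G yb)"
  proof -
    have "(\<tau> * minner M q xb / mu) *\<^sub>R (oblique_proj M q *v ?w) = (\<tau> / mu) *\<^sub>R (Q *v G yb)"
      unfolding oblique_proj_inv qxb QG by simp
    then have "z' = (1 / \<eta>2) *\<^sub>R ((1 - \<tau>) *\<^sub>R chart (coord z) + \<tau> *\<^sub>R chart yb - (\<tau> / mu) *\<^sub>R (Q *v G yb))"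
      unfolding z' cz xbc by simp
    then show ?thesis
      by (simp add: chart_def matrix_vector_right_distrib matrix_vector_mult_diff_distrib
          matrix_vector_mult_scaleR algebra_simps)
  qed
  show "0 < minner M q z'"
    unfolding z'_chart minner_scaled_chart using \<eta> by simp
  show "coord z' = (1 - \<tau>) *\<^sub>R coord z + \<tau> *\<^sub>R yb - (\<tau> / mu) *\<^sub>R G yb"
    unfolding z'_chart using \<eta> by (intro coord_scaled_chart) simp
  show "x' \<in> eic_dom A M q" using x' by (simp add: is_arg_min_def)
  have min: "Rq A M x' \<le> Rq A M v" if "v \<in> eic_dom A M q" "v \<in> ?S" for v
    using x' that unfolding is_arg_min_def by (meson IntI not_le)
  show "Rq A M x' \<le> Rq A M x" using xd by (intro min span_base) auto
  assume le: "F (yb - s *\<^sub>R G yb) \<le> rho"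
  \<comment> \<open>The competitor is the normalized chart point of the gradient step. It lies in
    the search space since \<open>Q *v G yb\<close> is a combination of \<open>q\<close> and
    \<open>matrix_inv M *v r\<close>.\<close>
  define y where "y = yb - s *\<^sub>R G yb"
  define c where "c = 1 / sqrt (1 + y \<bullet> y)"
  have y1: "0 < 1 + y \<bullet> y" by (simp add: add_pos_nonneg)
  then have c: "0 < c" "c * c * (1 + y \<bullet> y) = 1" by (auto simp: c_def)
  have mem: "q \<in> ?S" "xb \<in> ?S" "?w \<in> ?S" by (auto intro: span_base)
  have "chart y = chart yb - s *\<^sub>R (Q *v G yb)"
    by (simp add: y_def chart_def matrix_vector_mult_diff_distrib matrix_vector_mult_scaleR)
  also have "Q *v G yb = a *\<^sub>R (?w - minner M q ?w *\<^sub>R q)"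
    unfolding QG oblique_proj_inv[symmetric] oblique_proj_mult ..
  also have "chart yb = (1 / a) *\<^sub>R xb" unfolding xb_a using a by simp
  finally have "chart y \<in> ?S"
    using mem by (auto intro!: span_diff span_scale)
  then have "c *\<^sub>R chart y \<in> ?S" by (rule span_scale)
  moreover have R: "Rq A M (c *\<^sub>R chart y) = F y"
    using c by (simp add: Rq_scale Rq_chart)
  moreover have "c *\<^sub>R chart y \<in> eic_dom A M q"
  proof -
    have "minner M (c *\<^sub>R chart y) (c *\<^sub>R chart y) = c * c * minner M (chart y) (chart y)"
      by (simp add: minner_def matrix_vector_mult_scaleR)
    then have "mnorm M (c *\<^sub>R chart y) = 1" unfolding mnorm_def minner_M_chart c by simp
    then show ?thesis
      using c le R by (simp add: eic_dom_def minner_scaled_chart y_def)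
  qed
  ultimately show "Rq A M x' \<le> F (yb - s *\<^sub>R G yb)"
    using min[of "c *\<^sub>R chart y"] by (simp add: y_def)
qed

end

section \<open>The constants and the convergence theorem\<close>

text \<open>These are the numerical assumptions of \<open>eic_bounds\<close>. The size of
  \<open>chi\<close> gives \<open>18 eps < lam2 - lam1\<close> through \<open>chi \<ge> 16\<close>,
  and its exact form gives \<open>W = 8 (ximax / lam1) sqrt S eps\<close>.\<close>

lemma eic_constants:
  fixes lam1 lam2 lamn eps chi ximin ximax mu L :: real
  assumes lam1: "0 < lam1" and gap: "lam1 < lam2" and eps: "0 \<le> eps"
    and chi: "chi = 8 * lam2 / lam1 * (ximax / ximin) * sqrt ((lam2 + lam1) / (2 * (lam2 - lam1)))"
    and eps_less: "eps < (lam2 - lam1) / (2 + chi)"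
    and mu: "mu = 2 * ximin * (1 - 4 * eps / (lam2 - lam1)) * (1 - lam1 / lam2 - (2 + chi) / lam2 * eps)"
    and L: "L = 2 * ximax * (1 - lam1 / lamn + chi / lam2 * (ximin / ximax) * eps)"
    and ximin: "0 < ximin" "lam2 - eps \<le> ximin" "ximin \<le> ximax" and ximax: "ximax \<le> lamn"
  defines "p \<equiv> lam2 - lam1 - eps" and "m \<equiv> ximin - lam1" and "X \<equiv> ximax - lam1"
    and "W \<equiv> chi * ximin / lam2 * eps"
  shows "0 < p" and "17 * eps \<le> p" and "0 < mu" and "mu * p \<le> 2 * m * (p - 16 * eps)"
    and "2 * X + 2 * W \<le> L" and "0 \<le> W" and "60 * X * eps\<^sup>2 \<le> W\<^sup>2 * p" and "17 * W \<le> 18 * m"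
proof -
  define d where "d = lam2 - lam1"
  define S where "S = (lam2 + lam1) / (2 * d)"
  have d: "0 < d" and lam2: "0 < lam2" and S: "0 < S" and xx: "0 < ximax"
    using lam1 gap ximin by (auto simp: d_def S_def)
  have chiS: "chi = 8 * (lam2 / lam1) * (ximax / ximin) * sqrt S"
    unfolding chi S_def d_def by simp
  have chi16: "16 \<le> chi"
  proof -
    \<comment> \<open>\<open>(lam2 / lam1)\<^sup>2 S \<ge> 4\<close> is a cubic inequality in \<open>lam2 / lam1\<close>, proved by completing a square.\<close>
    have "0 \<le> (2 * d - 3 / 4 * lam1)\<^sup>2 + (2 - 9 / 16) * lam1\<^sup>2" by simp
    also have "\<dots> = 4 * d\<^sup>2 - 3 * d * lam1 + 2 * lam1\<^sup>2" by (simp add: power2_eq_square algebra_simps)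
    finally have "0 \<le> lam1 * (4 * d\<^sup>2 - 3 * d * lam1 + 2 * lam1\<^sup>2)"
      by (rule mult_nonneg_nonneg[OF less_imp_le[OF lam1]])
    moreover have "0 \<le> d\<^sup>2 * d" using d by simp
    ultimately have "0 \<le> d\<^sup>2 * d + lam1 * (4 * d\<^sup>2 - 3 * d * lam1 + 2 * lam1\<^sup>2)"
      by linarith
    also have "\<dots> = lam2\<^sup>2 * (lam2 + lam1) - 8 * d * lam1\<^sup>2"
      unfolding d_def by (simp add: power2_eq_square algebra_simps)
    finally have "2\<^sup>2 * (lam1\<^sup>2 * (2 * d)) \<le> lam2\<^sup>2 * (lam2 + lam1)" by (simp add: mult_ac)
    then have "2\<^sup>2 \<le> lam2\<^sup>2 * (lam2 + lam1) / (lam1\<^sup>2 * (2 * d))"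
      using d lam1 by (subst pos_le_divide_eq) auto
    also have "\<dots> = (lam2 / lam1)\<^sup>2 * S" by (simp add: S_def power_divide)
    also have "\<dots> = (lam2 / lam1 * sqrt S)\<^sup>2"
      using S by (simp add: power_mult_distrib power_divide)
    finally have "2 \<le> lam2 / lam1 * sqrt S"
      by (rule power2_le_imp_le) (use lam1 lam2 S in simp)
    then have "8 * 2 * 1 \<le> 8 * (lam2 / lam1 * sqrt S) * (ximax / ximin)"
      using ximin by (intro mult_mono) auto
    then show ?thesis unfolding chiS by (simp add: mult_ac)
  qed
  have ce: "(2 + chi) * eps < d"
    using eps_less chi16 by (simp add: d_def pos_less_divide_eq mult.commute)
  have "18 * eps \<le> (2 + chi) * eps" using chi16 eps by (intro mult_right_mono) auto
  then have e18: "18 * eps < d" using ce by linarith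
  have p: "p = d - eps" by (simp add: p_def d_def)
  show p0: "0 < p" and "17 * eps \<le> p" using e18 eps by (auto simp: p)
  have m0: "0 < m" using e18 eps ximin by (simp add: m_def d_def)
  \<comment> \<open>Equivalent to \<open>lam1 lam2 \<le> ximin (lam1 + eps)\<close>. It bounds the
    factor \<open>ximin / lam2\<close>, present in both \<open>mu\<close> and \<open>W\<close>, by
    \<open>m / p\<close>.\<close>
  have key: "ximin * p \<le> m * lam2"
  proof -
    have "lam1 * lam2 \<le> lam1 * lam2 + eps * p" using eps p0 by simp
    also have "\<dots> = (lam2 - eps) * (lam1 + eps)" by (simp add: p_def algebra_simps)
    also have "\<dots> \<le> ximin * (lam1 + eps)" using ximin lam1 eps by (intro mult_right_mono) auto
    finally show ?thesis by (simp add: p_def m_def algebra_simps)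
  qed
  define P where "P = (d - (2 + chi) * eps) / lam2"
  have P: "0 < P" using ce lam2 by (simp add: P_def)
  have muP: "mu = 2 * (ximin * P) * (1 - 4 * eps / d)"
  proof -
    have "1 - lam1 / lam2 - (2 + chi) / lam2 * eps = P"
      using lam2 by (simp add: P_def d_def diff_divide_distrib)
    then show ?thesis unfolding mu d_def by simp
  qed
  have f: "0 < 1 - 4 * eps / d" "1 - 4 * eps / d \<le> 1" using e18 eps d by simp_all
  show "0 < mu" unfolding muP using ximin P f by simp
  have "mu \<le> 2 * (ximin * P) * 1"
    unfolding muP using ximin P f by (intro mult_left_mono) auto
  also have "\<dots> \<le> 2 * (ximin * ((d - 18 * eps) / lam2))"
    using \<open>18 * eps \<le> (2 + chi) * eps\<close> ximin lam2
    by (simp add: P_def divide_right_mono)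
  finally have "mu * p \<le> 2 * (ximin * ((d - 18 * eps) / lam2)) * p"
    using p0 by (intro mult_right_mono) auto
  also have "\<dots> = 2 * (ximin * p) * ((d - 18 * eps) / lam2)" by simp
  also have "\<dots> \<le> 2 * (m * lam2) * ((d - 18 * eps) / lam2)"
    using key e18 lam2 by (intro mult_right_mono) auto
  also have "\<dots> = 2 * m * (d - 18 * eps)" using lam2 by simp
  also have "\<dots> \<le> 2 * m * (p - 16 * eps)" using m0 eps by (simp add: p)
  finally show "mu * p \<le> 2 * m * (p - 16 * eps)" .
  show W0: "0 \<le> W" using chi16 ximin lam2 eps by (simp add: W_def)
  have "ximax / lamn \<le> 1" using xx ximax by simp
  then have "lam1 * (ximax / lamn) \<le> lam1 * 1" using lam1 by (intro mult_left_mono) auto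
  moreover have "L = 2 * ximax - 2 * (lam1 * (ximax / lamn)) + 2 * W"
    unfolding L W_def using xx by (simp add: algebra_simps)
  ultimately show "2 * X + 2 * W \<le> L" by (simp add: X_def)
  have WS: "W = 8 * (ximax / lam1) * sqrt S * eps"
    unfolding W_def chiS using ximin lam2 by simp
  have "17 * d \<le> 18 * p" using e18 by (simp add: p)
  \<comment> \<open>The 64 is the square of the 8 in \<open>chi\<close>; rounding 60 up to 64 covers
    the passage from \<open>d\<close> to \<open>p\<close>.\<close>
  have "60 * X * eps\<^sup>2 * d \<le> 64 * ximax * eps\<^sup>2 * p"
  proof -
    have "60 * d \<le> 64 * p" using \<open>17 * d \<le> 18 * p\<close> p0 by linarith
    moreover have "X * eps\<^sup>2 \<le> ximax * eps\<^sup>2"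
      using lam1 by (intro mult_right_mono) (auto simp: X_def)
    ultimately have "(X * eps\<^sup>2) * (60 * d) \<le> (ximax * eps\<^sup>2) * (64 * p)"
      by (intro mult_mono[of "X * eps\<^sup>2"]) (use d xx in auto)
    then show ?thesis by (simp add: mult_ac)
  qed
  also have "\<dots> \<le> W\<^sup>2 * p * d"
  proof -
    have "ximax * lam1 \<le> ximax * ximax" using xx ximin m0 by (intro mult_left_mono) (auto simp: m_def)
    then have "ximax * lam1 * (2 * lam1) \<le> ximax * ximax * (lam2 + lam1)"
      using xx lam1 gap by (intro mult_mono) auto
    then have "ximax \<le> ximax * ximax * (lam2 + lam1) / (lam1 * (2 * lam1))"
      using lam1 by (simp add: pos_le_divide_eq mult_ac)
    also have "\<dots> = (ximax / lam1)\<^sup>2 * S * d"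
      using d by (simp add: S_def power2_eq_square)
    finally have "ximax \<le> (ximax / lam1)\<^sup>2 * S * d" .
    then have "64 * eps\<^sup>2 * p * ximax \<le> 64 * eps\<^sup>2 * p * ((ximax / lam1)\<^sup>2 * S * d)"
      using p0 by (intro mult_left_mono) auto
    also have "\<dots> = W\<^sup>2 * p * d"
      unfolding WS using S by (simp add: power_mult_distrib power_divide)
    finally show ?thesis by (simp add: mult_ac)
  qed
  finally show "60 * X * eps\<^sup>2 \<le> W\<^sup>2 * p" using d by simp
  have "W * lam2 = ximin * (chi * eps)" using lam2 by (simp add: W_def)
  also have "\<dots> \<le> ximin * d" using ce eps ximin by (intro mult_left_mono) (auto simp: algebra_simps)
  finally have "17 * (W * lam2) \<le> 17 * (ximin * d)" by simp
  also have "\<dots> = ximin * (17 * d)" by simp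
  also have "\<dots> \<le> ximin * (18 * p)" using \<open>17 * d \<le> 18 * p\<close> ximin by (intro mult_left_mono) auto
  also have "\<dots> \<le> 18 * (m * lam2)" using key by simp
  finally have "(17 * W) * lam2 \<le> (18 * m) * lam2" by simp
  then show "17 * W \<le> 18 * m" using lam2 by (rule mult_right_le_imp_le)
qed

theorem theorem4p1:
  fixes A M :: "real^'n^'n"
    and lam :: "nat \<Rightarrow> real" and u :: "nat \<Rightarrow> real^'n"
    and q :: "real^'n" and Q :: "real^'m^'n" and B :: "real^'m^'m"
    and rho ximin ximax chi mu L kappa tau :: real
    and x z :: "nat \<Rightarrow> real^'n"
  assumes dim: "CARD('n) = CARD('m) + 1"
    and A_spd: "sym_pos_def A" and M_spd: "sym_pos_def M"
    and lam1_pos: "0 < lam 1" and lam_gap: "lam 1 < lam 2"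
    and lam_mono: "mono_on {2..CARD('n)} lam"
    and eig: "\<And>i. i \<in> {1..CARD('n)} \<Longrightarrow> A *v u i = lam i *\<^sub>R (M *v u i)"
    and orth: "\<And>i j. \<lbrakk>i \<in> {1..CARD('n)}; j \<in> {1..CARD('n)}; i \<noteq> j\<rbrakk> \<Longrightarrow> minner M (u i) (u j) = 0"
    and u_norm: "\<And>i. i \<in> {1..CARD('n)} \<Longrightarrow> mnorm M (u i) = 1"
    and q_norm: "mnorm M q = 1" and q_u1: "minner M q (u 1) > 0"
    and rho_eq: "rho = Rq A M q"
    and qQ_orth: "transpose (prepend_col q Q) ** M ** prepend_col q Q = mat 1"
    and B_eq: "B = transpose Q ** A ** Q"
    and ximin_eq: "ximin = Min (real_spectrum B)" and ximax_eq: "ximax = Max (real_spectrum B)"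
    and chi_eq: "chi = 8 * lam 2 / lam 1 * (ximax / ximin)
                   * sqrt ((lam 2 + lam 1) / (2 * (lam 2 - lam 1)))"
    and mu_eq: "mu = 2 * ximin * (1 - 4 * (rho - lam 1) / (lam 2 - lam 1))
                   * (1 - lam 1 / lam 2 - (2 + chi) / lam 2 * (rho - lam 1))"
    and L_eq: "L = 2 * ximax * (1 - lam 1 / lam (CARD('n))
                   + chi / lam 2 * (ximin / ximax) * (rho - lam 1))"
    and kappa_eq: "kappa = L / mu"
    and rho_ge: "lam 1 \<le> rho"
    and rho_less: "rho < lam 1 + (lam 2 - lam 1) / (2 + chi)"
    and tau_pos: "0 < tau" and tau_le: "tau \<le> kappa powr (- 1 / 2)"
    and iter: "eic_iteration A M q mu tau x z"
    and x0_ge: "0 \<le> Rq A M (x 0) - lam 1"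
    and x0_le: "Rq A M (x 0) - lam 1
                  \<le> 1 / max (8 * kappa) (2 * kappa * (1 + tau * kappa)\<^sup>2) * (rho - lam 1)"
    and z0: "z 0 = x 0"
  shows "\<forall>k\<ge>1. (\<forall>j<k. Rq A M (x (Suc j)) \<le> Rq A M (x j)) \<and>
           Rq A M (x k) - lam 1 \<le> 2 * (1 - tau) ^ k * (Rq A M (x 0) - lam 1)"
proof -
  have "CARD('m) \<noteq> 0" by simp
  then have n2: "2 \<le> CARD('n)" using dim by simp
  then have I1: "1 \<in> {1..CARD('n)}" by simp
  interpret pf: pencil_frame A M q Q
    using A_spd M_spd dim qQ_orth by unfold_locales (auto simp: sym_pos_def_def)
  note A_sym = pf.A_sym and M_sym = pf.M_sym
  note quad = pencil_quadratic_bounds[OF A_sym M_sym n2 lam_gap lam_mono eig orth u_norm]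
  define eps where "eps = rho - lam 1"
  define \<delta> where "\<delta> = lam 2 - lam 1"
  define c where "c = minner M q (u 1)"
  define ys where "ys = pf.coord (u 1)"
  have c0: "0 < c" using q_u1 by (simp add: c_def)
  have u1: "u 1 = c *\<^sub>R pf.chart ys"
  proof -
    have "(1 / c) *\<^sub>R u 1 = pf.chart ys"
      unfolding c_def ys_def using q_u1 by (intro pf.chart_coord) simp
    then have "c *\<^sub>R ((1 / c) *\<^sub>R u 1) = c *\<^sub>R pf.chart ys" by simp
    then show ?thesis using c0 by simp
  qed
  have eig_chart: "A *v pf.chart ys = lam 1 *\<^sub>R (M *v pf.chart ys)"
  proof -
    have "c *\<^sub>R (A *v pf.chart ys) = c *\<^sub>R (lam 1 *\<^sub>R (M *v pf.chart ys))"
      using eig[OF I1] unfolding u1 by (simp add: matrix_vector_mult_scaleR)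
    then show ?thesis using c0 unfolding scaleR_cancel_left by simp
  qed
  \<comment> \<open>Testing the eigenvector equation of \<open>chart ys\<close> with
    \<open>Q\<close> and with \<open>q\<close> gives the two equations of
    \<open>rayleigh_chart\<close>.\<close>
  have ys_eq: "pf.bq + pf.BQ *v ys = lam 1 *\<^sub>R ys"
    by (simp only: pf.Q_A_chart[symmetric] eig_chart matrix_vector_mult_scaleR pf.Q_M_chart)
  have rho_ys: "rho + pf.bq \<bullet> ys = lam 1"
    using pf.q_A_chart[of ys] unfolding eig_chart rho_eq by (simp add: pf.q_M_chart)
  have cc: "c\<^sup>2 * (1 + ys \<bullet> ys) = 1"
  proof -
    have "minner M (u 1) (u 1) = 1" using u_norm[OF I1] by (simp add: mnorm_def)
    moreover have "minner M (u 1) (u 1) = c\<^sup>2 * minner M (pf.chart ys) (pf.chart ys)"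
      unfolding u1 by (simp add: minner_def matrix_vector_mult_scaleR power2_eq_square)
    ultimately show ?thesis by (simp only: pf.minner_M_chart)
  qed
  \<comment> \<open>\<open>c\<close> is the cosine of the M-angle between \<open>q\<close> and
    \<open>u 1\<close>; the spectral gap at \<open>q\<close> bounds the squared sine by
    \<open>eps / \<delta>\<close>.\<close>
  have c_eps: "\<delta> * (1 - c\<^sup>2) \<le> eps"
  proof -
    have "minner M (u 1) q = c"
      unfolding c_def minner_def by (metis M_sym inner_commute symmetric_inner)
    moreover have "minner A q q = rho" unfolding rho_eq pf.Rq_q by (simp add: minner_def)
    ultimately show ?thesis using quad(1)[of q] by (simp add: pf.minner_q_q \<delta>_def eps_def)
  qed
  have Q_A: "y \<bullet> (B *v y) = minner A (Q *v y) (Q *v y)" for y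
    unfolding B_eq minner_def
    by (simp only: matrix_vector_mul_assoc[symmetric] inner_commute[of y] transpose_inner)
      (simp only: inner_commute)
  have Q_M: "minner M (Q *v y) (Q *v y) = y \<bullet> y" for y
    using pf.frame_coordinates(2)[of 0 y] transpose_inner[of Q "M *v (Q *v y)" y]
    by (simp add: minner_def inner_commute del: transpose_matrix_vector)
  have u1_Q: "minner M (u 1) (Q *v y) = c * (ys \<bullet> y)" for y
  proof -
    have "minner M (u 1) (Q *v y) = (M *v u 1) \<bullet> (Q *v y)"
      unfolding minner_def by (rule symmetric_inner[OF M_sym, symmetric])
    also have "\<dots> = (transpose Q *v (M *v u 1)) \<bullet> y" by (rule transpose_inner[symmetric])
    also have "transpose Q *v (M *v u 1) = c *\<^sub>R ys"
      unfolding u1 by (simp only: matrix_vector_mult_scaleR pf.Q_M_chart)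
    finally show ?thesis by simp
  qed
  have B_sym: "transpose B = B"
    unfolding B_eq by (simp add: matrix_transpose_mul transpose_transpose A_sym matrix_mul_assoc)
  obtain w where w: "norm w = 1" "w \<bullet> (B *v w) = ximin"
    using Min_real_spectrum(2)[OF B_sym] ximin_eq by blast
  obtain v where v: "norm v = 1" "v \<bullet> (B *v v) = ximax"
    using Max_real_spectrum(2)[OF B_sym] ximax_eq by blast
  have B_low: "ximin * (y \<bullet> y) \<le> y \<bullet> (B *v y)" and B_up: "y \<bullet> (B *v y) \<le> ximax * (y \<bullet> y)" for y
    unfolding ximin_eq ximax_eq by (rule Min_real_spectrum(1)[OF B_sym], rule Max_real_spectrum(1)[OF B_sym])
  have ww: "w \<bullet> w = 1" and vv: "v \<bullet> v = 1" using w v by (simp_all add: norm_eq_1)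
  \<comment> \<open>\<open>Q *v w\<close> is M-orthogonal to \<open>q\<close>, so its component
    along \<open>u 1\<close> is at most that sine; the spectral gap at \<open>Q *v w\<close> then
    bounds \<open>ximin\<close> below.\<close>
  have ximin_ge: "lam 2 - eps \<le> ximin"
  proof -
    have "(c * (ys \<bullet> w))\<^sup>2 \<le> c\<^sup>2 * (ys \<bullet> ys)"
      using Cauchy_Schwarz_ineq[of ys w] by (simp add: power_mult_distrib ww mult_left_mono)
    also have "\<dots> = 1 - c\<^sup>2" using cc by (simp add: algebra_simps)
    finally have "\<delta> * (c * (ys \<bullet> w))\<^sup>2 \<le> \<delta> * (1 - c\<^sup>2)"
      using lam_gap by (intro mult_left_mono) (auto simp: \<delta>_def)
    then have "\<delta> * (c * (ys \<bullet> w))\<^sup>2 \<le> eps" using c_eps by linarith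
    moreover have "\<delta> * (1 - (c * (ys \<bullet> w))\<^sup>2) \<le> ximin - lam 1"
      using quad(1)[of "Q *v w"] unfolding Q_M u1_Q Q_A[symmetric] w ww \<delta>_def by simp
    ultimately show ?thesis by (simp add: \<delta>_def algebra_simps)
  qed
  have ximin_max: "ximin \<le> ximax" using B_up[of w] w ww by simp
  have ximax_le: "ximax \<le> lam (CARD('n))"
    using quad(2)[of "Q *v v"] unfolding Q_M Q_A[symmetric] v vv by simp
  have ximin_pos: "0 < ximin"
  proof -
    have "Q *v w \<noteq> 0" using Q_M[of w] ww by (auto simp: minner_def)
    then show ?thesis using A_spd unfolding w(2)[symmetric] Q_A by (simp add: sym_pos_def_def minner_def)
  qed
  have eps0: "0 \<le> eps" using rho_ge by (simp add: eps_def)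
  have eps_less: "eps < (lam 2 - lam 1) / (2 + chi)" using rho_less by (simp add: eps_def)
  define p m X W where "p = lam 2 - lam 1 - eps" "m = ximin - lam 1" "X = ximax - lam 1"
    "W = chi * ximin / lam 2 * eps"
  note const = eic_constants[OF lam1_pos lam_gap eps0 chi_eq eps_less mu_eq[folded eps_def]
      L_eq[folded eps_def] ximin_pos ximin_ge ximin_max ximax_le, folded p_m_X_W_def]
  \<comment> \<open>\<open>ys \<bullet> ys\<close> is the squared tangent
    \<open>(1 - c^2) / c^2\<close> of the same angle.\<close>
  have p_ys: "p * (ys \<bullet> ys) \<le> eps"
  proof -
    have "p \<le> \<delta> * c\<^sup>2" using c_eps by (simp add: p_m_X_W_def \<delta>_def algebra_simps)
    then have "p * (ys \<bullet> ys) \<le> \<delta> * c\<^sup>2 * (ys \<bullet> ys)" by (intro mult_right_mono) auto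
    also have "\<dots> = \<delta> * (1 - c\<^sup>2)"
    proof -
      have "c\<^sup>2 * (ys \<bullet> ys) = 1 - c\<^sup>2" using cc by (simp add: algebra_simps)
      then show ?thesis by (simp only: mult.assoc)
    qed
    finally show ?thesis using c_eps by linarith
  qed
  have pmX: "p \<le> m" "m \<le> X"
    using ximin_ge ximin_max by (simp_all add: p_m_X_W_def)
  have BB: "pf.BQ = B" by (simp add: B_eq)
  interpret eb: eic_bounds "(*v) B" pf.bq rho "lam 1" ys p m X eps mu L W
  proof (intro eic_bounds.intro rayleigh_chart.intro eic_bounds_axioms.intro)
    show "linear ((*v) B)" by (rule matrix_vector_mul_linear)
    show "(B *v a) \<bullet> b = a \<bullet> (B *v b)" for a b by (rule symmetric_inner[OF B_sym])
    show "pf.bq + B *v ys = lam 1 *\<^sub>R ys" using ys_eq unfolding BB .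
    show "m * (d \<bullet> d) \<le> d \<bullet> (B *v d - lam 1 *\<^sub>R d)" for d
      using B_low[of d] by (simp add: p_m_X_W_def inner_diff_right algebra_simps)
    show "d \<bullet> (B *v d - lam 1 *\<^sub>R d) \<le> X * (d \<bullet> d)" for d
      using B_up[of d] by (simp add: p_m_X_W_def inner_diff_right algebra_simps)
  qed (fact rho_ys const pmX eps0 p_ys)+
  let ?F = "rayleigh ((*v) B) pf.bq rho" and ?G = "rayleigh_grad ((*v) B) pf.bq rho"
  define Y Z where "Y k = pf.coord (x k)" and "Z k = pf.coord (z k)" for k
  define Yb where "Yb k = (1 / (1 + tau)) *\<^sub>R (Y k + tau *\<^sub>R Z k)" for k
  have Yb: "(1 + tau) *\<^sub>R Yb k = Y k + tau *\<^sub>R Z k" for k using tau_pos by (simp add: Yb_def)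
  have step: "eic_step A M q mu tau (x k) (z k) (x (Suc k)) (z (Suc k))" for k
    using iter by (simp add: eic_iteration_def)
  note step_chart = pf.eic_step_chart[OF step tau_pos _ _ Yb[unfolded Y_def Z_def],
      folded Y_def Z_def, unfolded BB, folded rho_eq]
  have dom: "x k \<in> eic_dom A M q \<and> 0 < minner M q (z k)" for k
  proof (induction k)
    case 0
    then show ?case using iter by (simp add: eic_iteration_def eic_dom_def)
  next
    case (Suc k)
    then show ?case using step_chart(1)[of k] step_chart(3)[of k] by simp
  qed
  have Rq_Y: "Rq A M (x k) = ?F (Y k)" for k
    using pf.Rq_coord[of "x k"] dom[of k] unfolding Y_def BB rho_eq by (simp add: eic_dom_def)
  have mono: "Rq A M (x (Suc k)) \<le> Rq A M (x k)" for k
    using step_chart(4)[of k] dom[of k] by simp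
  have kappa: "0 < kappa" using const(3) eb.L_pos by (simp add: kappa_eq)
  have tau_sq: "tau\<^sup>2 * L \<le> mu"
  proof -
    have "tau\<^sup>2 \<le> (kappa powr (- 1 / 2))\<^sup>2" using tau_le tau_pos by (intro power_mono) auto
    also have "\<dots> = kappa powr (-1)" by (simp add: power2_eq_square powr_add[symmetric])
    also have "\<dots> = mu / L" using kappa const(3) eb.L_pos by (simp add: powr_minus kappa_eq)
    finally show ?thesis using eb.L_pos by (simp add: field_simps)
  qed
  have start: "8 * L * (?F (Y 0) - lam 1) \<le> eps * mu"
  proof -
    have "?F (Y 0) - lam 1 \<le> 1 / max (8 * kappa) (2 * kappa * (1 + tau * kappa)\<^sup>2) * eps"
      using x0_le unfolding Rq_Y eps_def .
    also have "\<dots> \<le> 1 / (8 * kappa) * eps"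
      using kappa eps0 by (intro mult_right_mono divide_left_mono) auto
    also have "\<dots> = eps * mu / (8 * L)" by (simp add: kappa_eq)
    finally show ?thesis using eb.L_pos by (simp add: field_simps)
  qed
  have "?F (Y k) - lam 1 \<le> 2 * (1 - tau) ^ k * (?F (Y 0) - lam 1)" for k
  proof (rule eb.accelerated_convergence[where \<tau> = tau and Y = Y and Z = Z and Yb = Yb,
        OF tau_pos tau_sq _ start Yb])
    show "Z 0 = Y 0" by (simp add: Y_def Z_def z0)
    show "Z (Suc k) = (1 - tau) *\<^sub>R Z k + tau *\<^sub>R Yb k - (tau / mu) *\<^sub>R ?G (Yb k)" for k
      using step_chart(2)[of k] dom[of k] by simp
    show "?F (Y (Suc k)) \<le> ?F (Y k)" for k
      using mono[of k] unfolding Rq_Y .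
    show "?F (Y (Suc k)) \<le> ?F (Yb k - (1 / L) *\<^sub>R ?G (Yb k))"
      if "?F (Yb k - (1 / L) *\<^sub>R ?G (Yb k)) \<le> lam 1 + eps" for k
      using step_chart(5)[of k "1 / L"] dom[of k] that unfolding Rq_Y eps_def by simp
  qed
  then show ?thesis using mono unfolding Rq_Y by blast
qed

end
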